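(* Let $X$ be an mm-space with positive Cheeger constant. Then $X$ is essentially connected and satisfies $\mathrm{IC}(\nu)$ for some measure $\nu\in\mathcal V$. If, in addition, $I_X$ is Lebesgue measurable, then $$I_X\circ V=V'\quad\mathcal L^1\text{-a.e. (on } V^{-1}(\operatorname{Im}\mu_X)\text{, where the left-hand side is defined)}$$ for some $\nu\in\mathcal V$, where $V$ is the cumulative distribution function of $\nu$.
   Context: An mm-space is a complete separable metric space $(X,d_X)$ with a Borel probability measure $\mu_X$; it is assumed that $X=\operatorname{supp}\mu_X$. For a Borel set $A\subset X$, $\mu_X^+(A):=\limsup_{\varepsilon\to0+}\frac{\mu_X(U_\varepsilon(A))-\mu_X(A)}{\varepsilon}$, where $U_\varepsilon(A)$ is the open $\varepsilon$-neighborhood of $A$. $X$ is essentially connected if $\mu_X^+(A)>0$ for any closed set $A\subset X$ with $0<\mu_X(A)<1$. The Cheeger constant is $h(X):=\inf_{0<\mu_X(A)<1}\frac{\mu_X^+(A)}{\min\{\mu_X(A),\mu_X(X\setminus A)\}}$, the infimum over Borel sets $A\subset X$. $\operatorname{Im}\mu_X$ is the set of values $\mu_X(A)$, $A\subset X$ Borel. The isoperimetric profile $I_X:\operatorname{Im}\mu_X\to[0,+\infty)$ is $I_X(v):=\inf\{\mu_X^+(A)\mid A\subset X\text{ Borel},\ \mu_X(A)=v\}$. For a Borel probability measure $\nu$ on $\mathbb R$ with cumulative distribution function $V(t)=\nu((-\infty,t])$, $X$ satisfies $\mathrm{IC}(\nu)$ if $I_X\circ V\ge V'$ holds $\mathcal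 L^1$-a.e. on $V^{-1}(\operatorname{Im}\mu_X)$, where $\mathcal L^1$ is the Lebesgue measure on $\mathbb R$. $\mathcal V$ is the set of Borel probability measures on $\mathbb R$ absolutely continuous with respect to $\mathcal L^1$ and with connected support. *)

theory Defs
  imports "HOL-Probability.Probability"
begin

definition supp :: "'a::topological_space measure \<Rightarrow> 'a set" where
  "supp M = {x. \<forall>U. open U \<and> x \<in> U \<longrightarrow> 0 < emeasure M U}"

(* The metric space X is the whole type 'a; class polish_space consists of the complete
   separable metric spaces (with a fixed metric dist). *)
locale mm_space = prob_space M for M :: "'a::polish_space measure" +
  assumes sets_eq_borel: "sets M = sets borel"
    and full_supp: "supp M = UNIV"

definition nbhd :: "real \<Rightarrow> 'a::metric_space set \<Rightarrow> 'a set" where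
  "nbhd \<epsilon> A = (\<Union>a\<in>A. ball a \<epsilon>)"

(* The upper limit may be infinite, so all boundary quantities are valued in ennreal.
   The difference quotient is nonnegative, so ennreal does not truncate it. *)
definition boundary_measure :: "'a::metric_space measure \<Rightarrow> 'a set \<Rightarrow> ennreal" where
  "boundary_measure M A =
     Limsup (at_right 0) (\<lambda>\<epsilon>::real. ennreal ((measure M (nbhd \<epsilon> A) - measure M A) / \<epsilon>))"

definition essentially_connected :: "'a::metric_space measure \<Rightarrow> bool" where
  "essentially_connected M \<longleftrightarrow>
     (\<forall>A. closed A \<and> 0 < measure M A \<and> measure M A < 1 \<longrightarrow> 0 < boundary_measure M A)"

(* The infimum over the empty family is infinity, as for a one-point space. *)
definition cheeger :: "'a::metric_space measure \<Rightarrow> ennreal" where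
  "cheeger M =
     (INF A \<in> {A \<in> sets borel. 0 < measure M A \<and> measure M A < 1}.
        boundary_measure M A / ennreal (min (measure M A) (measure M (- A))))"

definition Im_measure :: "'a::topological_space measure \<Rightarrow> real set" where
  "Im_measure M = measure M ` sets borel"

(* Only meaningful for v in Im_measure M. The value infinity can occur, namely if every
   Borel set of measure v has infinite boundary measure. *)
definition iso_profile :: "'a::metric_space measure \<Rightarrow> real \<Rightarrow> ennreal" where
  "iso_profile M v = (INF A \<in> {A \<in> sets borel. measure M A = v}. boundary_measure M A)"

(* A cumulative distribution function is monotone, hence differentiable almost everywhere
   with nonnegative derivative; the unspecified values of deriv elsewhere do not matter. *)
definition IC :: "'a::metric_space measure \<Rightarrow> real measure \<Rightarrow> bool" where
  "IC M \<nu> \<longleftrightarrow>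
     (AE t in lebesgue. cdf \<nu> t \<in> Im_measure M \<longrightarrow>
        iso_profile M (cdf \<nu> t) \<ge> ennreal (deriv (cdf \<nu>) t))"

definition ac_connected :: "real measure set" ("\<V>") where
  "\<V> = {\<nu>. real_distribution \<nu> \<and> absolutely_continuous lborel \<nu> \<and> connected (supp \<nu>)}"

end

theory Submission
  imports Defs
begin

text \<open>
  A positive Cheeger constant gives some \<open>c > 0\<close> with \<open>c * min v (1 - v) \<le> iso_profile M v\<close> for
  \<open>0 < v < 1\<close>, and in particular essential connectedness. The distribution functions \<open>V\<close> come
  from the autonomous equation \<open>V' = J \<circ> V\<close>: for every Borel \<open>J\<close> with
  \<open>J v \<ge> c * min v (1 - v)\<close>, the function \<open>T w = (\<integral>x=1/2..w. 1 / J x)\<close> is finite, continuous and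
  strictly increasing on the open unit interval, and \<open>V\<close> is its inverse
  (\<open>ex_distribution_with_profile\<close>). The choice \<open>J v = c * min v (1 - v)\<close> gives the
  isoperimetric comparison. If the profile is measurable, one takes for \<open>J\<close> a Borel function that
  agrees with the profile at almost every value of \<open>M\<close>, and obtains equality.

  As \<open>V'\<close> is real, equality is possible only if the profile is finite at almost every value of
  \<open>M\<close>. That this follows from a positive Cheeger constant is the heart of the proof
  (\<open>finite_profile_off_countable\<close>). The distribution function of the distance from a point has slope
  bounded below, by the Cheeger inequality applied to balls (\<open>cdf_distr_steep\<close>). So the measure
  charges the radii of linear growth, at which balls have finite perimeter, and by a Steinhaus
  argument for the distribution function (\<open>ex_cdf_difference\<close>) there is a shell that contains sets
  of finite perimeter of every intermediate measure. An approximation by finite perimeter outside the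
  shell is thereby corrected to a prescribed measure; only countably many values escape.

  Both parts rest on the weak-type maximal inequality (\<open>weak_type_bound\<close>), a consequence of Vitali's
  covering lemma: it yields the radii of linear growth and Lebesgue's differentiation theorem.
\<close>

section \<open>Comparison of measures on the line and the maximal inequality\<close>

lemma finite_borel_measureI:
  assumes "finite_measure N" "sets N = sets borel"
  shows "finite_borel_measure N"
  using assms by (simp add: finite_borel_measure_def finite_borel_measure_axioms_def)

text \<open>
  Half-open intervals of a fixed small length tile the line. For a compact set inside an open one,
  the tiles that meet the compact set stay inside the open set, so summing the hypothesis over them
  compares the two; regularity of both measures then gives all Borel sets.
\<close>
lemma measure_le_of_Ioc_le:
  assumes N1: "finite_borel_measure N1" and N2: "finite_borel_measure N2"
    and le: "\<And>a b. a < b \<Longrightarrow> measure N1 {a<..b} \<le> measure N2 {a<..b}"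
    and B: "B \<in> sets borel"
  shows "measure N1 B \<le> measure N2 B"
proof -
  interpret N1: finite_borel_measure N1 by fact
  interpret N2: finite_borel_measure N2 by fact
  have compact_open: "measure N1 K \<le> measure N2 U" if K: "compact K" and U: "open U" and KU: "K \<subseteq> U" for K U
  proof -
    obtain e where e: "e > 0" "(\<Union>x\<in>K. cball x e) \<subseteq> U"
      using compact_subset_open_imp_cball_epsilon_subset[OF K U KU] by blast
    define C where "C i = {real_of_int i * e <.. (real_of_int i + 1) * e}" for i :: int
    define idx where "idx t = \<lceil>t / e\<rceil> - 1" for t :: real
    have idx: "t \<in> C (idx t)" for t
    proof -
      have "t / e \<le> real_of_int \<lceil>t / e\<rceil>" "real_of_int \<lceil>t / e\<rceil> < t / e + 1"
        by linarith+
      then have "t / e * e \<le> real_of_int \<lceil>t / e\<rceil> * e" "real_of_int \<lceil>t / e\<rceil> * e < (t / e + 1) * e"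
        using e(1) by (auto intro: mult_right_mono mult_strict_right_mono simp del: nonzero_divide_eq_eq times_divide_eq_left)
      then have "t \<le> real_of_int \<lceil>t / e\<rceil> * e" "real_of_int \<lceil>t / e\<rceil> * e < t + e"
        using e(1) by (simp_all add: distrib_right)
      then show ?thesis using e(1) by (auto simp: C_def idx_def algebra_simps)
    qed
    have "idx t = i" if "t \<in> C i" for t i
    proof -
      have "real_of_int i < t / e" "t / e \<le> real_of_int i + 1"
        using that e(1) by (auto simp: C_def field_simps)
      then have "\<lceil>t / e\<rceil> = i + 1" by linarith
      then show ?thesis by (simp add: idx_def)
    qed
    then have disj: "disjoint_family_on C I" for I
      unfolding disjoint_family_on_def by (metis disjoint_iff)
    obtain b where b: "\<And>t. t \<in> K \<Longrightarrow> \<bar>t\<bar> \<le> b"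
      using compact_imp_bounded[OF K] by (auto simp: bounded_real)
    have "idx t \<in> {idx (-b)..idx b}" if "t \<in> K" for t
    proof -
      have "-b/e \<le> t/e" "t/e \<le> b/e" using b[OF that] e(1) by (auto simp: divide_right_mono abs_le_iff field_simps)
      then show ?thesis unfolding idx_def by (auto intro!: ceiling_mono simp: field_simps)
    qed
    then have fin: "finite (idx ` K)"
      by (meson finite_atLeastAtMost_int finite_subset image_subsetI)
    have CU: "C i \<subseteq> U" if "i \<in> idx ` K" for i
    proof
      fix s assume s: "s \<in> C i"
      from that obtain t where t: "t \<in> K" "i = idx t" by auto
      with idx have "t \<in> C i" by simp
      with s have "dist t s \<le> e" by (auto simp: C_def dist_real_def algebra_simps)
      then have "s \<in> cball t e" by simp
      with e(2) t(1) show "s \<in> U" by blast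
    qed
    have Cb: "C i \<in> sets borel" for i by (simp add: C_def)
    have Cs: "C ` idx ` K \<subseteq> sets N1" "C ` idx ` K \<subseteq> sets N2"
      unfolding N1.M_is_borel N2.M_is_borel using Cb by blast+
    have "measure N1 K \<le> measure N1 (\<Union>i\<in>idx ` K. C i)"
    proof (rule N1.finite_measure_mono)
      show "K \<subseteq> (\<Union>i\<in>idx ` K. C i)" using idx by blast
      show "(\<Union>i\<in>idx ` K. C i) \<in> sets N1" using Cs(1) fin by (intro sets.finite_UN) auto
    qed
    also have "\<dots> = (\<Sum>i\<in>idx ` K. measure N1 (C i))"
      by (intro N1.finite_measure_finite_Union fin disj Cs)
    also have "\<dots> \<le> (\<Sum>i\<in>idx ` K. measure N2 (C i))"
      using e(1) by (intro sum_mono) (auto simp: C_def intro!: le)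
    also have "\<dots> = measure N2 (\<Union>i\<in>idx ` K. C i)"
      by (intro N2.finite_measure_finite_Union[symmetric] fin disj Cs)
    also have "\<dots> \<le> measure N2 U"
      using CU U by (intro N2.finite_measure_mono) (auto simp: N2.M_is_borel)
    finally show ?thesis .
  qed
  have fin: "emeasure N1 (space N1) \<noteq> \<infinity>" "emeasure N2 (space N2) \<noteq> \<infinity>" by simp_all
  have "emeasure N1 B \<le> emeasure N2 B"
    unfolding inner_regular[OF N1.M_is_borel fin(1) B] outer_regular[OF N2.M_is_borel fin(2) B]
  proof (intro SUP_least INF_greatest)
    fix K U assume "K \<in> {K. K \<subseteq> B \<and> compact K}" "U \<in> {U. B \<subseteq> U \<and> open U}"
    then have "measure N1 K \<le> measure N2 U" by (intro compact_open) auto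
    then show "emeasure N1 K \<le> emeasure N2 U"
      by (simp add: N1.emeasure_eq_measure N2.emeasure_eq_measure)
  qed
  then show ?thesis by (simp add: N1.emeasure_eq_measure N2.emeasure_eq_measure)
qed

text \<open>
  The weak-type inequality for the maximal function of a measure \<open>N\<close>: a disjoint Vitali subfamily of
  the intervals that are heavy for \<open>N\<close> still covers after enlarging by the factor 5, and its
  total length is controlled by \<open>N\<close>. The set \<open>U\<close> localises the bound; the covering set
  \<open>V\<close> appears because \<open>S\<close> may fail to be measurable.
\<close>
lemma weak_type_bound:
  assumes N: "finite_borel_measure N" and l: "l > 0" and U: "U \<in> sets borel"
    and S: "\<And>t. t \<in> S \<Longrightarrow> \<exists>h>0. cball t h \<subseteq> U \<and> l * h < measure N (cball t h)"
  obtains V where "V \<in> sets borel" "S \<subseteq> V" "emeasure lborel V \<le> ennreal (10 / l * measure N U)"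
proof -
  interpret N: finite_borel_measure N by fact
  define P where "P = {(t, h). 0 < h \<and> cball t h \<subseteq> U \<and> l * h < measure N (cball t h)}"
  have SP: "S \<subseteq> (\<Union>i\<in>P. cball (fst i) (snd i))"
  proof
    fix t assume "t \<in> S"
    from S[OF this] obtain h where "(t, h) \<in> P" "h > 0" by (auto simp: P_def)
    then show "t \<in> (\<Union>i\<in>P. cball (fst i) (snd i))"
      by (intro UN_I[of "(t,h)"]) auto
  qed
  have rB: "0 < snd i \<and> snd i \<le> measure N (space N) / l" if "i \<in> P" for i
  proof -
    have "l * snd i < measure N (cball (fst i) (snd i))" using that by (auto simp: P_def)
    also have "\<dots> \<le> measure N (space N)" by (rule N.bounded_measure)
    finally show ?thesis using that l by (auto simp: P_def field_simps)
  qed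
  obtain C where C: "countable C" "C \<subseteq> P"
    "pairwise (\<lambda>i j. disjnt (cball (fst i) (snd i)) (cball (fst j) (snd j))) C"
    "S \<subseteq> (\<Union>i\<in>C. cball (fst i) (5 * snd i))"
    using Vitali_covering_lemma_cballs[OF SP rB] .
  define V where "V = (\<Union>i\<in>C. cball (fst i) (5 * snd i))"
  have V: "V \<in> sets borel" unfolding V_def using C(1) by (intro sets.countable_UN') auto
  have fin_bound: "emeasure lborel (\<Union>i\<in>D. cball (fst i) (5 * snd i)) \<le> ennreal (10 / l * measure N U)"
    if D: "finite D" "D \<subseteq> C" for D
  proof -
    have DP: "i \<in> P" if "i \<in> D" for i using that D C(2) by auto
    have "emeasure lborel (\<Union>i\<in>D. cball (fst i) (5 * snd i))
        \<le> (\<Sum>i\<in>D. emeasure lborel (cball (fst i) (5 * snd i)))"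
      by (intro emeasure_subadditive_finite D) auto
    also have "\<dots> = (\<Sum>i\<in>D. ennreal (10 * snd i))"
      by (intro sum.cong refl) (use rB DP in \<open>force simp: cball_eq_atLeastAtMost\<close>)
    also have "\<dots> = ennreal (\<Sum>i\<in>D. 10 * snd i)"
      using rB DP by (intro sum_ennreal) force
    also have "\<dots> \<le> ennreal (10 / l * measure N U)"
    proof (rule ennreal_leI)
      have "(\<Sum>i\<in>D. 10 * snd i) \<le> (\<Sum>i\<in>D. 10 / l * measure N (cball (fst i) (snd i)))"
        using DP l by (intro sum_mono) (force simp: P_def field_simps)
      also have "\<dots> = 10 / l * (\<Sum>i\<in>D. measure N (cball (fst i) (snd i)))"
        by (simp add: sum_distrib_left)
      also have "(\<Sum>i\<in>D. measure N (cball (fst i) (snd i))) = measure N (\<Union>i\<in>D. cball (fst i) (snd i))"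
      proof (intro N.finite_measure_finite_Union[symmetric])
        show "disjoint_family_on (\<lambda>i. cball (fst i) (snd i)) D"
          using C(3) D(2) unfolding disjoint_family_on_def pairwise_def disjnt_def by (metis subsetD)
      qed (use D in \<open>auto simp: N.M_is_borel\<close>)
      also have "\<dots> \<le> measure N U"
        using DP U by (intro N.finite_measure_mono UN_least) (simp_all add: P_def N.M_is_borel split_beta)
      finally show "(\<Sum>i\<in>D. 10 * snd i) \<le> 10 / l * measure N U" using l by (simp add: mult_left_mono divide_right_mono)
    qed
    finally show ?thesis .
  qed
  have "emeasure lborel V \<le> ennreal (10 / l * measure N U)"
  proof (cases "C = {}")
    case False
    define X where "X n = (\<Union>i\<in>from_nat_into C ` {..n}. cball (fst i) (5 * snd i))" for n :: nat
    have "V = (\<Union>n. X n)"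
    proof -
      have "C = range (from_nat_into C)" using range_from_nat_into[OF False C(1)] by simp
      then show ?thesis unfolding V_def X_def by blast
    qed
    moreover have "incseq X" unfolding X_def by (fastforce intro!: incseq_SucI)
    moreover have "range X \<subseteq> sets lborel" unfolding X_def by (auto intro!: sets.finite_UN)
    ultimately have "emeasure lborel V = (SUP n. emeasure lborel (X n))"
      by (simp add: SUP_emeasure_incseq)
    also have "\<dots> \<le> ennreal (10 / l * measure N U)"
      unfolding X_def using False by (intro SUP_least fin_bound) (auto intro: from_nat_into)
    finally show ?thesis .
  qed (simp add: V_def)
  with V C(4) show ?thesis by (intro that[of V]) (simp_all add: V_def)
qed

text \<open>
  These are the radii at which the measure grows at most linearly, so that level sets at such radii
  have a finite Minkowski content. The complementary set is open and, by the weak-type bound, short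
  once \<open>C\<close> is large; this makes the good set compact and of positive length.
\<close>
lemma ex_linear_growth_set:
  assumes N: "finite_borel_measure N" and ab: "a < b"
  obtains C K where "compact K" "K \<subseteq> {a..b}" "emeasure lborel K > 0"
    "\<And>t h. t \<in> K \<Longrightarrow> 0 < h \<Longrightarrow> measure N (cball t h) \<le> C * h"
proof -
  interpret N: finite_borel_measure N by fact
  \<comment> \<open>With this constant the bad set has length at most \<open>10 / C * measure N UNIV < b - a\<close>.\<close>
  define C where "C = 20 * (measure N UNIV + 1) / (b - a)"
  have C: "C > 0" using ab by (simp add: C_def add_nonneg_pos)
  define K where "K = {t\<in>{a..b}. \<forall>h>0. measure N (cball t h) \<le> C * h}"
  define Bad where "Bad = {t. \<exists>h>0. C * h < measure N (cball t h)}"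
  have K_eq: "K = {a..b} - Bad" by (auto simp: K_def Bad_def not_less)
  have "open Bad"
    unfolding open_dist
  proof
    fix t assume "t \<in> Bad"
    then obtain h where h: "h > 0" "C * h < measure N (cball t h)" by (auto simp: Bad_def)
    define e where "e = (measure N (cball t h) - C * h) / C"
    have e: "e > 0" using h C by (simp add: e_def)
    have "s \<in> Bad" if s: "dist s t < e" for s
    proof -
      have "C * (h + dist s t) < C * (h + e)" using s C by simp
      also have "\<dots> = measure N (cball t h)" using C by (simp add: e_def field_simps)
      also have "\<dots> \<le> measure N (cball s (h + dist s t))"
      proof (intro N.finite_measure_mono)
        show "cball t h \<subseteq> cball s (h + dist s t)"
          by (auto simp: dist_real_def)
      qed (simp add: N.M_is_borel)
      finally show ?thesis unfolding Bad_def using h(1) by (auto intro!: exI[of _ "h + dist s t"] add_pos_nonneg)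
    qed
    with e show "\<exists>e>0. \<forall>s. dist s t < e \<longrightarrow> s \<in> Bad" by blast
  qed
  then have cK: "compact K" unfolding K_eq by (intro compact_diff) auto
  obtain V where V: "V \<in> sets borel" "Bad \<subseteq> V" "emeasure lborel V \<le> ennreal (10 / C * measure N UNIV)"
    using weak_type_bound[OF N C, of UNIV Bad] by (auto simp: Bad_def)
  have "C * (b - a) = 20 * (measure N UNIV + 1)" using ab by (simp add: C_def)
  then have "10 / C * measure N UNIV < b - a"
    using C by (simp add: pos_divide_less_eq mult.commute) (simp add: add_nonneg_pos add_increasing)
  then have "emeasure lborel V < ennreal (b - a)"
    using V(3) by (meson ab diff_gt_0_iff_gt ennreal_lessI order_le_less_trans)
  moreover have "ennreal (b - a) \<le> emeasure lborel K + emeasure lborel V"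
  proof -
    have "ennreal (b - a) = emeasure lborel {a..b}" using ab by simp
    also have "\<dots> \<le> emeasure lborel (K \<union> V)"
      using V cK by (intro emeasure_mono) (auto simp: K_eq borel_compact)
    also have "\<dots> \<le> emeasure lborel K + emeasure lborel V"
      using V cK by (intro emeasure_subadditive) (auto simp: borel_compact)
    finally show ?thesis .
  qed
  ultimately have "emeasure lborel K > 0" by (metis add.left_neutral not_gr_zero not_less)
  moreover have "K \<subseteq> {a..b}" by (auto simp: K_def)
  ultimately show ?thesis using cK by (intro that[of K C]) (auto simp: K_def)
qed

section \<open>Lebesgue's differentiation theorem\<close>

text \<open>
  Outside a set of small length, the derivative of \<open>N\<close> on \<open>E\<close> only sees the mass of an open
  neighbourhood of \<open>E\<close>, and that mass can be made arbitrarily small.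
\<close>
lemma AE_zero_upper_derivative:
  assumes N: "finite_borel_measure N" and E: "E \<in> sets borel" and NE: "measure N E = 0"
  shows "AE t in lborel. t \<in> E \<longrightarrow>
    (\<forall>l>0. \<exists>d>0. \<forall>h. 0 < h \<and> h < d \<longrightarrow> measure N (cball t h) \<le> l * h)"
proof -
  interpret N: finite_borel_measure N by fact
  define Bad where "Bad l = {t \<in> E. \<forall>d>0. \<exists>h. 0 < h \<and> h < d \<and> l * h < measure N (cball t h)}" for l :: real
  have small_cover: "\<exists>V\<in>sets borel. Bad l \<subseteq> V \<and> emeasure lborel V \<le> ennreal e" if "l > 0" "e > 0" for l e
  proof -
    have fin: "emeasure N (space N) \<noteq> \<infinity>" by simp
    have "emeasure N E < ennreal (l * e / 10)"
      using NE that by (simp add: N.emeasure_eq_measure)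
    then obtain U where U: "E \<subseteq> U" "open U" "emeasure N U < ennreal (l * e / 10)"
      unfolding outer_regular[OF N.M_is_borel fin E] by (auto simp: INF_less_iff)
    have "\<exists>h>0. cball t h \<subseteq> U \<and> l * h < measure N (cball t h)" if t: "t \<in> Bad l" for t
    proof -
      obtain d where d: "d > 0" "cball t d \<subseteq> U"
        using U(1,2) t unfolding Bad_def open_contains_cball by blast
      with t obtain h where "0 < h" "h < d" "l * h < measure N (cball t h)" by (auto simp: Bad_def)
      with d show ?thesis by (intro exI[of _ h]) (auto intro: subset_trans[OF subset_cball])
    qed
    then obtain V where V: "V \<in> sets borel" "Bad l \<subseteq> V" "emeasure lborel V \<le> ennreal (10 / l * measure N U)"
      using weak_type_bound[OF N \<open>l > 0\<close>, of U "Bad l"] U by auto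
    have "10 / l * measure N U \<le> e"
      using U(3) that by (simp add: N.emeasure_eq_measure ennreal_less_iff field_simps)
    with V show ?thesis by (meson ennreal_leI order_trans)
  qed
  have Bad_null: "AE t in lborel. t \<notin> Bad l" if l: "l > 0" for l
  proof -
    have "\<forall>k. \<exists>V\<in>sets borel. Bad l \<subseteq> V \<and> emeasure lborel V \<le> ennreal (1 / Suc k)"
      using small_cover[OF l] by simp
    then obtain V where V: "\<And>k. V k \<in> sets borel" "\<And>k. Bad l \<subseteq> V k"
      "\<And>k. emeasure lborel (V k) \<le> ennreal (1 / Suc k)" by metis
    have "emeasure lborel (\<Inter>k. V k) \<le> 0 + ennreal e" if "e > 0" for e :: real
    proof -
      obtain k where "1 / real (Suc k) < e" using \<open>e > 0\<close> nat_approx_posE by metis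
      have "emeasure lborel (\<Inter>k. V k) \<le> emeasure lborel (V k)" using V(1) by (intro emeasure_mono) auto
      also have "\<dots> \<le> ennreal (1 / Suc k)" by (rule V)
      also have "\<dots> \<le> ennreal e" using \<open>1 / real (Suc k) < e\<close> by (intro ennreal_leI) simp
      finally show ?thesis by simp
    qed
    then have "emeasure lborel (\<Inter>k. V k) \<le> 0" by (rule ennreal_le_epsilon)
    then have "(\<Inter>k. V k) \<in> null_sets lborel" using V(1) by (auto simp: null_sets_def)
    then show ?thesis by (rule AE_I') (use V(2) in blast)
  qed
  have "AE t in lborel. \<forall>k::nat. t \<notin> Bad (1 / Suc k)"
    by (subst AE_all_countable) (auto intro!: Bad_null)
  then show ?thesis
  proof (rule AE_mp, intro AE_I2 impI allI)
    fix t and l :: real assume t: "\<forall>k::nat. t \<notin> Bad (1 / Suc k)" "t \<in> E" and l: "0 < l"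
    obtain k where k: "1 / real (Suc k) < l" using l nat_approx_posE by metis
    from t obtain d where d: "d > 0" "\<And>h. 0 < h \<Longrightarrow> h < d \<Longrightarrow> measure N (cball t h) \<le> 1 / Suc k * h"
      unfolding Bad_def mem_Collect_eq by (metis not_less)
    have "measure N (cball t h) \<le> l * h" if "0 < h" "h < d" for h
      using d(2)[OF that] k that by (meson less_imp_le mult_right_mono order_trans)
    with d(1) show "\<exists>d>0. \<forall>h. 0 < h \<and> h < d \<longrightarrow> measure N (cball t h) \<le> l * h" by blast
  qed
qed

text \<open>
  Lebesgue's differentiation theorem. For a rational \<open>q\<close>, the excess of the density over
  \<open>q\<close> defines a measure that does not charge the set where the density is at most \<open>q\<close>,
  so it has derivative 0 at almost every point of that set; there the upper derivative of the
  distribution function is at most \<open>q\<close>. The deficit below \<open>q\<close> handles the lower derivative.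
\<close>
lemma AE_cdf_density_real_derivative:
  fixes j :: "real \<Rightarrow> real"
  assumes j[measurable]: "j \<in> borel_measurable borel" and j0: "\<And>t. 0 \<le> j t"
    and fin: "finite_measure (density lborel (\<lambda>t. ennreal (j t)))"
  shows "AE t in lborel. (cdf (density lborel (\<lambda>t. ennreal (j t))) has_real_derivative j t) (at t)"
proof -
  define N where "N = density lborel (\<lambda>t. ennreal (j t))"
  interpret N: finite_borel_measure N
    using fin by (intro finite_borel_measureI) (simp_all add: N_def)
  define Over where "Over q = density lborel (\<lambda>t. ennreal (j t - q))" for q
  \<comment> \<open>The deficit has infinite total mass on the line, hence the truncation to a bounded interval.\<close>
  define Under where "Under q n = density lborel (\<lambda>t. ennreal (q - j t) * indicator {-real n..real n} t)" for q and n :: nat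
  have Over: "finite_borel_measure (Over q)" if "q \<ge> 0" for q
  proof (rule finite_borel_measureI)
    have "emeasure (Over q) UNIV \<le> emeasure N UNIV"
      using that by (auto simp: Over_def N_def emeasure_density intro!: nn_integral_mono ennreal_leI)
    also have "\<dots> < \<infinity>" by (simp add: less_top[symmetric])
    finally show "finite_measure (Over q)" by (intro finite_measureI) (auto simp: Over_def)
  qed (simp add: Over_def)
  have Under: "finite_borel_measure (Under q n)" for q n
  proof (rule finite_borel_measureI)
    have "emeasure (Under q n) UNIV \<le> (\<integral>\<^sup>+t. ennreal q * indicator {-real n..real n} t \<partial>lborel)"
      using j0 by (auto simp: Under_def emeasure_density intro!: nn_integral_mono mult_right_mono ennreal_leI)
    also have "\<dots> < \<infinity>" by (simp add: nn_integral_cmult ennreal_mult_less_top)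
    finally show "finite_measure (Under q n)" by (intro finite_measureI) (auto simp: Under_def)
  qed (simp add: Under_def)
  define small where "small R t \<longleftrightarrow> (\<forall>l>0. \<exists>d>0. \<forall>h. 0 < h \<and> h < d \<longrightarrow> measure R (cball t h) \<le> l * h)"
    for R :: "real measure" and t
  have "AE t in lborel. j t \<le> q \<longrightarrow> small (Over q) t" if "q \<ge> 0" for q
  proof -
    have "emeasure (Over q) {t. j t \<le> q} = 0"
      by (auto simp: Over_def emeasure_density nn_integral_0_iff_AE indicator_def ennreal_eq_0_iff)
    then show ?thesis
      using AE_zero_upper_derivative[OF Over[OF that], of "{t. j t \<le> q}"] by (simp add: measure_def small_def)
  qed
  then have A1: "AE t in lborel. \<forall>q\<in>\<rat>. q \<ge> 0 \<longrightarrow> j t \<le> q \<longrightarrow> small (Over q) t"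
    by (subst AE_ball_countable[OF countable_rat]) auto
  have "AE t in lborel. j t \<ge> q \<longrightarrow> small (Under q n) t" for q n
  proof -
    have "emeasure (Under q n) {t. j t \<ge> q} = 0"
      by (auto simp: Under_def emeasure_density nn_integral_0_iff_AE indicator_def ennreal_eq_0_iff)
    then show ?thesis
      using AE_zero_upper_derivative[OF Under, of "{t. j t \<ge> q}"] by (simp add: measure_def small_def)
  qed
  then have A2: "AE t in lborel. \<forall>n. \<forall>q\<in>\<rat>. j t \<ge> q \<longrightarrow> small (Under q n) t"
    by (simp add: AE_all_countable AE_ball_countable[OF countable_rat])
  have le_Over: "measure N {x<..y} \<le> q * (y - x) + measure (Over q) {x<..y}" if "x \<le> y" "q \<ge> 0" for x y q
  proof -
    interpret O: finite_borel_measure "Over q" using that by (intro Over)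
    have "emeasure N {x<..y} \<le> (\<integral>\<^sup>+t. (ennreal q + ennreal (j t - q)) * indicator {x<..y} t \<partial>lborel)"
      unfolding N_def using that j0
      by (auto simp: emeasure_density indicator_def ennreal_plus_if intro!: nn_integral_mono ennreal_leI)
    also have "\<dots> = ennreal q * ennreal (y - x) + emeasure (Over q) {x<..y}"
      using that by (simp add: Over_def emeasure_density distrib_right nn_integral_add nn_integral_cmult)
    finally show ?thesis
      using that by (simp add: N.emeasure_eq_measure O.emeasure_eq_measure ennreal_mult[symmetric] ennreal_plus[symmetric] del: ennreal_plus)
  qed
  have Under_le: "q * (y - x) \<le> measure N {x<..y} + measure (Under q n) {x<..y}"
    if "x \<le> y" "- real n \<le> x" "y \<le> real n" "q \<ge> 0" for x y q n
  proof -
    interpret U: finite_borel_measure "Under q n" by (intro Under)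
    have "ennreal q * ennreal (y - x) = (\<integral>\<^sup>+t. ennreal q * indicator {x<..y} t \<partial>lborel)"
      using that by (simp add: nn_integral_cmult)
    also have "\<dots> \<le> (\<integral>\<^sup>+t. ennreal (j t) * indicator {x<..y} t
        + ennreal (q - j t) * indicator {-real n..real n} t * indicator {x<..y} t \<partial>lborel)"
      using that j0 by (auto simp: indicator_def ennreal_plus_if intro!: nn_integral_mono ennreal_leI)
    also have "\<dots> = emeasure N {x<..y} + emeasure (Under q n) {x<..y}"
      by (simp add: Under_def N_def emeasure_density nn_integral_add)
    finally show ?thesis
      using that by (simp add: N.emeasure_eq_measure U.emeasure_eq_measure ennreal_mult[symmetric] ennreal_plus[symmetric] del: ennreal_plus)
  qed
  have "AE t in lborel. (cdf N has_real_derivative j t) (at t)"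
    using A1 A2
  proof eventually_elim
    case (elim t)
    have close: "\<exists>d>0. \<forall>x y. x \<le> y \<longrightarrow> 0 < y - x \<longrightarrow> y - x < d \<longrightarrow> {x<..y} \<subseteq> cball t (y - x)
        \<longrightarrow> t \<in> {x..y} \<longrightarrow> \<bar>measure N {x<..y} - j t * (y - x)\<bar> \<le> e * (y - x)"
      if e: "e > 0" for e
    proof -
      obtain q where q: "q \<in> \<rat>" "j t < q" "q < j t + e / 2"
        using Rats_dense_in_real[of "j t" "j t + e / 2"] e by auto
      obtain p where p: "p \<in> \<rat>" "0 \<le> p" "p \<le> j t" "j t - e / 2 < p"
      proof (cases "j t = 0")
        case True with e show ?thesis by (intro that[of 0]) auto
      next
        case False
        with j0[of t] e have "max 0 (j t - e / 2) < j t" by auto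
        then obtain p where "p \<in> \<rat>" "max 0 (j t - e / 2) < p" "p < j t"
          using Rats_dense_in_real by metis
        then show ?thesis by (intro that[of p]) auto
      qed
      obtain n :: nat where n: "\<bar>t\<bar> + 1 \<le> real n" using real_arch_simple by blast
      have q0: "q \<ge> 0" using q j0[of t] by simp
      have "small (Over q) t" "small (Under p n) t" using elim q q0 p by auto
      moreover have "e / 2 > 0" using e by simp
      ultimately obtain d1 d2 where d1: "d1 > 0" "\<And>h. 0 < h \<Longrightarrow> h < d1 \<Longrightarrow> measure (Over q) (cball t h) \<le> e / 2 * h"
        and d2: "d2 > 0" "\<And>h. 0 < h \<Longrightarrow> h < d2 \<Longrightarrow> measure (Under p n) (cball t h) \<le> e / 2 * h"
        unfolding small_def by metis
      interpret O: finite_borel_measure "Over q" using q0 by (intro Over)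
      interpret U: finite_borel_measure "Under p n" by (intro Under)
      show ?thesis
      proof (intro exI[of _ "min 1 (min d1 d2)"] conjI allI impI)
        fix x y assume xy: "x \<le> y" "0 < y - x" "y - x < min 1 (min d1 d2)" "{x<..y} \<subseteq> cball t (y - x)" "t \<in> {x..y}"
        define h where "h = y - x"
        have "measure (Over q) {x<..y} \<le> measure (Over q) (cball t h)"
          using xy by (intro O.finite_measure_mono) (auto simp: O.M_is_borel h_def)
        then have a: "measure (Over q) {x<..y} \<le> e / 2 * h" using d1(2)[of h] xy by (simp add: h_def)
        have "measure (Under p n) {x<..y} \<le> measure (Under p n) (cball t h)"
          using xy by (intro U.finite_measure_mono) (auto simp: U.M_is_borel h_def)
        then have b: "measure (Under p n) {x<..y} \<le> e / 2 * h" using d2(2)[of h] xy by (simp add: h_def)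
        have "measure N {x<..y} \<le> q * h + e / 2 * h" using le_Over[OF xy(1) q0] a by (simp add: h_def)
        also have "q * h \<le> (j t + e / 2) * h" using q xy by (intro mult_right_mono) (auto simp: h_def)
        finally have 1: "measure N {x<..y} - j t * h \<le> e * h" by (simp add: algebra_simps)
        have "(j t - e / 2) * h \<le> p * h" using p xy by (intro mult_right_mono) (auto simp: h_def)
        also have "p * h \<le> measure N {x<..y} + e / 2 * h"
        proof -
          have "- real n \<le> x" "y \<le> real n" using xy n by (auto simp: abs_le_iff)
          from Under_le[OF xy(1) this p(2)] b show ?thesis by (simp add: h_def)
        qed
        finally have "j t * h - measure N {x<..y} \<le> e * h" by (simp add: algebra_simps)
        with 1 show "\<bar>measure N {x<..y} - j t * (y - x)\<bar> \<le> e * (y - x)" by (simp add: h_def abs_le_iff)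
      qed (use d1(1) d2(1) in auto)
    qed
    show "(cdf N has_real_derivative j t) (at t)"
      unfolding DERIV_def
    proof (rule LIM_I)
      fix e :: real assume "e > 0"
      then have "e / 2 > 0" by simp
      from close[OF this] obtain d where d: "d > 0" "\<And>x y. x \<le> y \<Longrightarrow> 0 < y - x \<Longrightarrow> y - x < d \<Longrightarrow> {x<..y} \<subseteq> cball t (y - x)
        \<Longrightarrow> t \<in> {x..y} \<Longrightarrow> \<bar>measure N {x<..y} - j t * (y - x)\<bar> \<le> e / 2 * (y - x)" by metis
      have "norm ((cdf N (t + h) - cdf N t) / h - j t) < e" if h: "h \<noteq> 0" "norm (h - 0) < d" for h
      proof -
        define x y where "x = min t (t + h)" and "y = max t (t + h)"
        have xy: "x \<le> y" "0 < y - x" "y - x < d" "{x<..y} \<subseteq> cball t (y - x)" "t \<in> {x..y}" "y - x = \<bar>h\<bar>"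
          using h by (auto simp: x_def y_def dist_real_def min_def max_def)
        have slope: "(cdf N (t + h) - cdf N t) / h = measure N {x<..y} / (y - x)"
        proof (cases "h > 0")
          case True then show ?thesis by (simp add: x_def y_def N.cdf_diff_eq)
        next
          case False
          with h have "h < 0" by simp
          then have "cdf N t - cdf N (t + h) = measure N {x<..y}"
            by (simp add: x_def y_def N.cdf_diff_eq)
          with \<open>h < 0\<close> show ?thesis by (simp add: x_def y_def field_simps)
        qed
        have "\<bar>(cdf N (t + h) - cdf N t) / h - j t\<bar> = \<bar>measure N {x<..y} - j t * (y - x)\<bar> / (y - x)"
        proof -
          have "measure N {x<..y} / (y - x) - j t = (measure N {x<..y} - j t * (y - x)) / (y - x)"
            using xy(2) by (simp add: diff_divide_distrib)
          with slope show ?thesis using xy(2) by (simp add: abs_divide)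
        qed
        also have "\<dots> \<le> e / 2" using d(2)[OF xy(1-5)] xy(2) by (simp add: divide_le_eq)
        also have "\<dots> < e" using \<open>e > 0\<close> by simp
        finally show ?thesis by simp
      qed
      with d(1) show "\<exists>s>0. \<forall>h. h \<noteq> 0 \<and> norm (h - 0) < s \<longrightarrow> norm ((cdf N (t + h) - cdf N t) / h - j t) < e" by blast
    qed
  qed
  then show ?thesis by (simp add: N_def)
qed

lemma AE_cdf_density_derivative:
  fixes g :: "real \<Rightarrow> ennreal"
  assumes g[measurable]: "g \<in> borel_measurable borel" and fin: "finite_measure (density lborel g)"
  shows "AE t in lborel. (cdf (density lborel g) has_real_derivative enn2real (g t)) (at t)"
proof -
  interpret finite_measure "density lborel g" by fact
  have "(\<integral>\<^sup>+t. g t \<partial>lborel) \<noteq> \<infinity>" using emeasure_finite[of UNIV] by (simp add: emeasure_density)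
  then have "AE t in lborel. g t \<noteq> \<infinity>" by (intro nn_integral_PInf_AE) auto
  then have eq: "density lborel g = density lborel (\<lambda>t. ennreal (enn2real (g t)))"
    by (intro density_cong) (auto simp: less_top)
  show ?thesis
    using AE_cdf_density_real_derivative[of "\<lambda>t. enn2real (g t)"] fin unfolding eq by simp
qed

section \<open>Distributions with a prescribed profile\<close>

text \<open>
  The autonomous equation \<open>V' = J \<circ> V\<close> is solved by the inverse of
  \<open>T w = (\<integral>x=1/2..w. 1 / J x)\<close>. The lower bound on \<open>J\<close> makes \<open>T\<close> finite and
  continuous inside the unit interval, and finiteness of \<open>J\<close> makes it strictly increasing. The
  measure \<open>\<nu>\<close> is the image under \<open>T\<close> of the uniform distribution, so its distribution
  function inverts \<open>T\<close>. The measure \<open>\<rho>\<close> with density \<open>1 / J\<close> is pushed by \<open>T\<close> to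
  Lebesgue measure on the range \<open>S\<close> of \<open>T\<close>; since the uniform distribution has density
  \<open>J\<close> with respect to \<open>\<rho>\<close>, its image has density \<open>J \<circ> V\<close> on \<open>S\<close>, and
  differentiation gives the equation almost everywhere. The same identity shows that \<open>V\<close> takes
  values in a null set only on a null set of times.
\<close>
lemma ex_distribution_with_profile:
  fixes J :: "real \<Rightarrow> real"
  assumes c: "c > 0" and J[measurable]: "J \<in> borel_measurable borel"
    and J_lower: "\<And>w. 0 < w \<Longrightarrow> w < 1 \<Longrightarrow> c * min w (1 - w) \<le> J w"
    and E: "E \<in> null_sets lborel"
  obtains \<nu> where "\<nu> \<in> \<V>"
    "AE t in lborel. (cdf \<nu> t \<in> {0, 1} \<and> deriv (cdf \<nu>) t = 0) \<or>
       (cdf \<nu> t \<in> {0<..<1} - E \<and> deriv (cdf \<nu>) t = J (cdf \<nu> t))"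
proof -
  have J_pos: "J w > 0" if "0 < w" "w < 1" for w
  proof -
    have "0 < c * min w (1 - w)" using c that by simp
    with J_lower[OF that] show ?thesis by linarith
  qed
  define r where "r w = ennreal (inverse (J w)) * indicator {0<..<1} w" for w
  have r[measurable]: "r \<in> borel_measurable borel" unfolding r_def by measurable
  define \<rho> where "\<rho> = density lborel r"
  have sets_\<rho>[measurable_cong, simp]: "sets \<rho> = sets borel" by (simp add: \<rho>_def)
  have \<rho>_upper: "emeasure \<rho> {u<..w} \<le> ennreal ((w - u) / (c * min p (1 - q)))"
    if "0 < p" "p \<le> u" "u \<le> w" "w \<le> q" "q < 1" for p q u w
  proof -
    have m: "c * min p (1 - q) > 0" using c that by simp
    have "r x * indicator {u<..w} x \<le> ennreal (inverse (c * min p (1 - q))) * indicator {u<..w} x" for x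
    proof (cases "x \<in> {u<..w}")
      case True
      then have "c * min p (1 - q) \<le> c * min x (1 - x)" using c that by (intro mult_left_mono) auto
      also have "\<dots> \<le> J x" using True that by (intro J_lower) auto
      finally have "inverse (J x) \<le> inverse (c * min p (1 - q))" using m by (intro le_imp_inverse_le) auto
      then show ?thesis using True that by (simp add: r_def ennreal_leI)
    qed simp
    then have "emeasure \<rho> {u<..w} \<le> (\<integral>\<^sup>+x. ennreal (inverse (c * min p (1 - q))) * indicator {u<..w} x \<partial>lborel)"
      by (simp add: \<rho>_def emeasure_density nn_integral_mono)
    also have "\<dots> = ennreal ((w - u) / (c * min p (1 - q)))"
      using that m by (subst nn_integral_cmult_indicator) (auto simp: ennreal_mult[symmetric] divide_inverse mult.commute[of "w - u"] simp del: inverse_mult_distrib)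
    finally show ?thesis .
  qed
  have \<rho>_fin: "emeasure \<rho> {u<..w} \<noteq> \<infinity>" if "0 < u" "w < 1" for u w
  proof (cases "u \<le> w")
    case True
    then show ?thesis using \<rho>_upper[of u u w w] that by (auto simp: top_unique)
  qed simp
  have \<rho>_pos: "measure \<rho> {u<..w} > 0" if "0 < u" "u < w" "w < 1" for u w
  proof -
    have "emeasure \<rho> {u<..w} \<noteq> 0"
    proof
      assume "emeasure \<rho> {u<..w} = 0"
      then have "AE x in lborel. r x * indicator {u<..w} x = 0"
        by (simp add: \<rho>_def emeasure_density nn_integral_0_iff_AE)
      then have "AE x in lborel. x \<notin> {u<..w}"
      proof (rule AE_mp, intro AE_I2 impI notI)
        fix x assume "r x * indicator {u<..w} x = 0" "x \<in> {u<..w}"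
        with that J_pos[of x] show False by (auto simp: r_def ennreal_eq_0_iff)
      qed
      then have "{u<..w} \<in> null_sets lborel" by (subst AE_iff_null_sets) auto
      then have "emeasure lborel {u<..w} = 0" by (rule null_setsD1)
      with that show False by simp
    qed
    then show ?thesis using \<rho>_fin[of u w] that by (simp add: measure_def enn2real_positive_iff less_top zero_less_iff_neq_zero)
  qed
  have \<rho>_add: "measure \<rho> {u<..w} = measure \<rho> {u<..v} + measure \<rho> {v<..w}"
    if "0 < u" "u \<le> v" "v \<le> w" "w < 1" for u v w
  proof -
    have "{u<..w} = {u<..v} \<union> {v<..w}" using that by auto
    then show ?thesis using \<rho>_fin[of u v] \<rho>_fin[of v w] that by (simp add: measure_Union)
  qed
  \<comment> \<open>Outside the unit interval \<open>T\<close> gets the value 0; the uniform distribution does not see it.\<close>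
  define T0 where "T0 w = (if 1/2 \<le> w then measure \<rho> {1/2<..w} else - measure \<rho> {w<..1/2})" for w :: real
  define T where "T w = (if w \<in> {0<..<1} then T0 w else 0)" for w
  have T_diff: "T w - T u = measure \<rho> {u<..w}" if "0 < u" "u \<le> w" "w < 1" for u w
    using \<rho>_add[of "1/2" u w] \<rho>_add[of u "1/2" w] \<rho>_add[of u w "1/2"] that by (auto simp: T_def T0_def)
  have T_mono: "T u < T w" if "0 < u" "u < w" "w < 1" for u w
    using \<rho>_pos[OF that] T_diff[of u w] that by simp
  have T_le_iff: "T u \<le> T w \<longleftrightarrow> u \<le> w" if "0 < u" "u < 1" "0 < w" "w < 1" for u w
    using T_mono[of u w] T_mono[of w u] that by (cases u w rule: linorder_cases) auto
  have T_cont: "continuous_on {0<..<1} T"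
  proof (subst continuous_on_eq_continuous_at; (intro ballI)?)
    fix w :: real assume w: "w \<in> {0<..<1}"
    define p q where "p = w / 2" and "q = (1 + w) / 2"
    have pq: "0 < p" "p < w" "w < q" "q < 1" using w by (auto simp: p_def q_def)
    define L where "L = 1 / (c * min p (1 - q))"
    have L: "L \<ge> 0" using c pq by (simp add: L_def)
    have Lip: "T y - T x \<le> L * (y - x)" if "p \<le> x" "x \<le> y" "y \<le> q" for x y
    proof -
      have "T y - T x = measure \<rho> {x<..y}" using that pq by (intro T_diff) auto
      also have "\<dots> \<le> (y - x) / (c * min p (1 - q))"
        using \<rho>_upper[of p x y q] that pq c unfolding measure_def by (intro enn2real_leI) auto
      finally show ?thesis by (simp add: L_def)
    qed
    have "L-lipschitz_on {p..q} T"
    proof (rule lipschitz_onI)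
      fix x y assume "x \<in> {p..q}" "y \<in> {p..q}"
      then show "dist (T x) (T y) \<le> L * dist x y"
        using Lip[of x y] Lip[of y x] T_le_iff[of x y] T_le_iff[of y x] pq
        by (cases "x \<le> y") (auto simp: dist_real_def abs_real_def)
    qed (rule L)
    then have "continuous_on {p..q} T" by (rule lipschitz_on_continuous_on)
    then show "isCont T w" using pq by (intro continuous_on_interior) (auto simp: interior_atLeastAtMost_real)
  qed simp
  have T[measurable]: "T \<in> borel_measurable borel"
  proof -
    have "(\<lambda>w. if w \<in> {0<..<1} then T w else 0) \<in> borel_measurable borel"
      by (intro borel_measurable_continuous_on_if T_cont) auto
    also have "(\<lambda>w. if w \<in> {0<..<1} then T w else 0) = T" by (auto simp: T_def)
    finally show ?thesis .
  qed
  define S where "S = T ` {0<..<1}"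
  have S_conn: "connected S" unfolding S_def by (intro connected_continuous_image T_cont) simp
  \<comment> \<open>An exhaustion of the open unit interval; the shift by 3 keeps it nondegenerate at \<open>n = 0\<close>.\<close>
  define p q where "p n = 1 / (real n + 3)" and "q n = 1 - 1 / (real n + 3)" for n
  have pq: "0 < p n" "p n < q n" "q n < 1" for n by (auto simp: p_def q_def field_simps)
  have pq_mono: "p (Suc n) \<le> p n" "q n \<le> q (Suc n)" for n by (auto simp: p_def q_def field_simps)
  have pq_cover: "\<exists>n. p n < w \<and> w \<le> q n" if "0 < w" "w < 1" for w
  proof -
    have "0 < min w (1 - w)" using that by simp
    then obtain n where n: "1 / real (Suc n) < min w (1 - w)" by (rule nat_approx_posE)
    have "1 / (real n + 3) \<le> 1 / real (Suc n)" by (simp add: field_simps)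
    with n show ?thesis by (intro exI[of _ n]) (auto simp: p_def q_def)
  qed
  have T_Ioc: "{T u<..T w} \<subseteq> T ` {u<..w}" if "0 < u" "u < w" "w < 1" for u w
  proof
    fix y assume y: "y \<in> {T u<..T w}"
    have "continuous_on {u..w} T" using that by (intro continuous_on_subset[OF T_cont]) auto
    moreover have "u \<le> w" using that by simp
    ultimately obtain x where "u \<le> x" "x \<le> w" "T x = y" using IVT'[of T u y w] y by auto
    with y show "y \<in> T ` {u<..w}" by (intro image_eqI[of _ _ x]) (auto simp: less_le)
  qed
  have S_Union: "S = (\<Union>n. {T (p n)<..T (q n)})"
  proof (intro equalityI subsetI)
    fix y assume "y \<in> S"
    then obtain w where w: "0 < w" "w < 1" "y = T w" by (auto simp: S_def)
    from pq_cover[OF w(1,2)] obtain n where "p n < w" "w \<le> q n" by blast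
    then have "T (p n) < T w" "T w \<le> T (q n)"
      using T_mono[of "p n" w] T_le_iff[of w "q n"] w pq[of n] by auto
    with w(3) show "y \<in> (\<Union>n. {T (p n)<..T (q n)})" by auto
  next
    fix y assume "y \<in> (\<Union>n. {T (p n)<..T (q n)})"
    then obtain n where "y \<in> {T (p n)<..T (q n)}" by blast
    with T_Ioc[of "p n" "q n"] pq[of n] have "y \<in> T ` {p n<..q n}" by auto
    then show "y \<in> S" using pq[of n] by (auto simp: S_def)
  qed
  have S[measurable]: "S \<in> sets borel" unfolding S_Union by auto

  \<comment> \<open>Both sides are finite measures in \<open>B\<close>, so comparing distribution functions is enough.\<close>
  have push_Ioc: "emeasure \<rho> ({u<..w} \<inter> T -` B) = emeasure lborel ({T u<..T w} \<inter> B)"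
    if uw: "0 < u" "u < w" "w < 1" and B: "B \<in> sets borel" for u w B
  proof -
    define N1 where "N1 = distr (density \<rho> (indicator {u<..w})) borel T"
    define N2 where "N2 = density lborel (indicator {T u<..T w} :: real \<Rightarrow> ennreal)"
    have N1: "emeasure N1 X = emeasure \<rho> ({u<..w} \<inter> T -` X)" if [measurable]: "X \<in> sets borel" for X
    proof -
      have "T -` X \<in> sets borel" using measurable_sets[OF T that] by simp
      then show ?thesis unfolding N1_def by (subst emeasure_distr) (auto simp: emeasure_restricted \<rho>_def)
    qed
    have N2: "emeasure N2 X = emeasure lborel ({T u<..T w} \<inter> X)" if "X \<in> sets borel" for X
      using that unfolding N2_def by (subst emeasure_restricted) auto
    have "finite_borel_measure N1"
      using N1[of UNIV] \<rho>_fin[of u w] uw by (intro finite_borel_measureI finite_measureI) (auto simp: N1_def)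
    moreover have "finite_borel_measure N2"
      using N2[of UNIV] T_mono[OF uw] by (intro finite_borel_measureI finite_measureI) (auto simp: N2_def)
    moreover have "cdf N1 t = cdf N2 t" for t
    proof -
      consider "t < T u" | "t \<in> {T u<..T w}" | "T w < t" | "t = T u" by fastforce
      then have "emeasure N1 {..t} = emeasure N2 {..t}"
      proof cases
        case 1
        then have "{u<..w} \<inter> T -` {..t} = {}" "{T u<..T w} \<inter> {..t} = {}"
          using T_mono[of u] uw by (fastforce dest: order.strict_trans2)+
        then show ?thesis by (simp add: N1 N2)
      next
        case 2
        then obtain x where x: "x \<in> {u<..w}" "t = T x" using T_Ioc[OF uw] by blast
        have "{u<..w} \<inter> T -` {..t} = {u<..x}" using x uw T_le_iff by auto
        moreover have "{T u<..T w} \<inter> {..t} = {T u<..T x}" using 2 x by auto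
        moreover have "emeasure \<rho> {u<..x} = ennreal (T x - T u)"
          using T_diff[of u x] \<rho>_fin[of u x] x uw by (simp add: emeasure_eq_ennreal_measure)
        ultimately show ?thesis using T_mono[of u x] x uw by (simp add: N1 N2)
      next
        case 3
        have "T x \<le> t" if "x \<in> {u<..w}" for x
          using 3 uw that T_le_iff[of x w] by auto
        then have "{u<..w} \<inter> T -` {..t} = {u<..w}" by auto
        moreover have "{T u<..T w} \<inter> {..t} = {T u<..T w}" using 3 by auto
        moreover have "emeasure \<rho> {u<..w} = ennreal (T w - T u)"
          using T_diff[of u w] \<rho>_fin[of u w] uw by (simp add: emeasure_eq_ennreal_measure)
        ultimately show ?thesis using T_mono[OF uw] by (simp add: N1 N2)
      next
        case 4
        then have "{u<..w} \<inter> T -` {..t} = {}" "{T u<..T w} \<inter> {..t} = {}"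
          using T_mono[of u] uw by (fastforce dest: order.strict_trans2)+
        then show ?thesis by (simp add: N1 N2)
      qed
      then show ?thesis by (simp add: cdf_def measure_def)
    qed
    ultimately have "N1 = N2" by (intro cdf_unique') auto
    then show ?thesis using N1[OF B] N2[OF B] by simp
  qed
  have push: "distr \<rho> borel T = density lborel (indicator S)"
  proof (rule measure_eqI)
    fix B assume "B \<in> sets (distr \<rho> borel T)"
    then have B[measurable]: "B \<in> sets borel" by simp
    have TB: "T -` B \<in> sets borel" using measurable_sets[OF T B] by simp
    have "emeasure \<rho> (T -` B) = emeasure \<rho> ({0<..<1} \<inter> T -` B)"
      using TB unfolding \<rho>_def by (simp add: emeasure_density r_def) (intro nn_integral_cong, auto simp: indicator_def)
    also have "{0<..<1} = (\<Union>n. {p n<..q n})"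
    proof (intro equalityI subsetI)
      fix w assume "w \<in> (\<Union>n. {p n<..q n})"
      then obtain n where "p n < w" "w \<le> q n" by auto
      with pq[of n] show "w \<in> {0<..<1}" by auto
    qed (use pq_cover in auto)
    also have "(\<Union>n. {p n<..q n}) \<inter> T -` B = (\<Union>n. {p n<..q n} \<inter> T -` B)" by blast
    also have "emeasure \<rho> \<dots> = (SUP n. emeasure \<rho> ({p n<..q n} \<inter> T -` B))"
    proof (intro SUP_emeasure_incseq[symmetric] incseq_SucI)
      show "{p n<..q n} \<inter> T -` B \<subseteq> {p (Suc n)<..q (Suc n)} \<inter> T -` B" for n
        using pq_mono[of n] by auto
    qed (use TB in auto)
    also have "\<dots> = (SUP n. emeasure lborel ({T (p n)<..T (q n)} \<inter> B))"
      using push_Ioc[OF pq B] by simp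
    also have "\<dots> = emeasure lborel (\<Union>n. {T (p n)<..T (q n)} \<inter> B)"
    proof (intro SUP_emeasure_incseq incseq_SucI)
      fix n
      have "T (p (Suc n)) \<le> T (p n)" "T (q n) \<le> T (q (Suc n))"
        using pq[of n] pq[of "Suc n"] pq_mono[of n] by (subst T_le_iff; linarith)+
      then show "{T (p n)<..T (q n)} \<inter> B \<subseteq> {T (p (Suc n))<..T (q (Suc n))} \<inter> B" by auto
    qed auto
    also have "(\<Union>n. {T (p n)<..T (q n)} \<inter> B) = S \<inter> B" unfolding S_Union by auto
    also have "emeasure lborel (S \<inter> B) = emeasure (density lborel (indicator S)) B"
      by (subst emeasure_restricted) auto
    finally show "emeasure (distr \<rho> borel T) B = emeasure (density lborel (indicator S)) B"
      by (simp add: emeasure_distr \<rho>_def)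
  qed simp

  define U where "U = density lborel (indicator {0<..<1} :: real \<Rightarrow> ennreal)"
  have U_emeasure: "emeasure U X = emeasure lborel ({0<..<1} \<inter> X)" if "X \<in> sets borel" for X
    using that unfolding U_def by (subst emeasure_restricted) auto
  have sets_U[measurable_cong, simp]: "sets U = sets borel" by (simp add: U_def)
  define \<nu> where "\<nu> = distr U borel T"
  interpret U: prob_space U using U_emeasure[of UNIV] by (intro prob_spaceI) (simp add: U_def)
  interpret \<nu>: real_distribution \<nu> unfolding \<nu>_def by (intro U.real_distribution_distr) simp
  define V where "V = cdf \<nu>"
  have V[measurable]: "V \<in> borel_measurable borel"
    unfolding V_def by (intro borel_measurable_mono monoI \<nu>.cdf_nondecreasing)
  have \<nu>_emeasure: "emeasure \<nu> X = emeasure lborel ({0<..<1} \<inter> T -` X)" if "X \<in> sets borel" for X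
    using that measurable_sets[OF T that] by (simp add: \<nu>_def emeasure_distr U_emeasure)
  have VT: "V (T w) = w" if w: "0 < w" "w < 1" for w
  proof -
    have "{0<..<1} \<inter> T -` {..T w} = {0<..w}" using w T_le_iff by auto
    then show ?thesis using w by (simp add: V_def cdf_def measure_def \<nu>_emeasure)
  qed
  have V_outside: "V t \<in> {0, 1}" if t: "t \<notin> S" for t
  proof -
    have "(\<forall>w\<in>{0<..<1}. T w \<le> t) \<or> (\<forall>w\<in>{0<..<1}. t < T w)"
    proof (rule ccontr)
      assume "\<not> ?thesis"
      then obtain u w where uw: "u \<in> {0<..<1}" "t < T u" "w \<in> {0<..<1}" "T w \<le> t" by (auto simp: not_le not_less)
      have "is_interval S" using S_conn by (simp add: is_interval_connected_1)
      then have "t \<in> S"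
        by (rule mem_is_interval_1_I[of S "T w" "T u"]) (use uw in \<open>auto simp: S_def\<close>)
      with t show False by simp
    qed
    then have "{0<..<1} \<inter> T -` {..t} = {0<..<1} \<or> {0<..<1} \<inter> T -` {..t} = {}" by fastforce
    then show ?thesis by (auto simp: V_def cdf_def measure_def \<nu>_emeasure)
  qed
  define g where "g t = indicator S t * ennreal (J (V t))" for t
  have g[measurable]: "g \<in> borel_measurable borel" unfolding g_def by measurable
  have \<nu>_density: "\<nu> = density lborel g"
  proof -
    have "inverse (J w) * J w = 1" if "0 < w" "w < 1" for w
      using J_pos[OF that] by simp
    then have "U = density \<rho> (\<lambda>w. ennreal (J (V (T w))))"
      unfolding U_def \<rho>_def
      by (subst density_density_eq)
        (auto intro!: density_cong AE_I2 simp: r_def indicator_def VT ennreal_mult[symmetric] less_imp_le J_pos)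
    then have "\<nu> = density (distr \<rho> borel T) (\<lambda>t. ennreal (J (V t)))"
      unfolding \<nu>_def by (subst density_distr) (auto simp: \<rho>_def)
    also have "\<dots> = density lborel g"
      unfolding push by (subst density_density_eq) (auto simp: g_def[abs_def])
    finally show ?thesis .
  qed
  have deriv: "AE t in lborel. (V has_real_derivative enn2real (g t)) (at t)"
    using AE_cdf_density_derivative[OF g] \<nu>.finite_measure_axioms by (simp add: \<nu>_density[symmetric] V_def)
  have avoid: "AE t in lborel. t \<in> S \<longrightarrow> V t \<notin> E"
  proof -
    have E_sets: "E \<in> sets borel" using E by auto
    have "AE w in lborel. w \<notin> E" using E by (rule AE_not_in)
    then have "AE w in \<rho>. V (T w) \<notin> E"
      unfolding \<rho>_def by (subst AE_density) (auto simp: r_def VT indicator_def elim!: eventually_mono)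
    then have "AE t in distr \<rho> borel T. V t \<notin> E"
      using E_sets by (subst AE_distr_iff) (auto simp: \<rho>_def)
    then show ?thesis unfolding push by (subst (asm) AE_density) (auto simp: indicator_def elim!: eventually_mono)
  qed
  have "AE t in lborel. (V t \<in> {0, 1} \<and> deriv V t = 0) \<or> (V t \<in> {0<..<1} - E \<and> deriv V t = J (V t))"
    using deriv avoid
  proof eventually_elim
    case (elim t)
    have D: "deriv V t = enn2real (g t)" using elim(1) by (rule DERIV_imp_deriv)
    show ?case
    proof (cases "t \<in> S")
      case True
      then obtain w where w: "0 < w" "w < 1" "t = T w" by (auto simp: S_def)
      with VT have "V t = w" by simp
      with w True elim(2) D J_pos[of w] show ?thesis by (simp add: g_def)
    next
      case False
      with D V_outside[OF False] show ?thesis by (simp add: g_def)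
    qed
  qed
  moreover have "\<nu> \<in> \<V>"
  proof -
    have "S \<subseteq> supp \<nu>"
    proof
      fix t assume "t \<in> S"
      then obtain w where w: "0 < w" "w < 1" "t = T w" by (auto simp: S_def)
      show "t \<in> supp \<nu>"
        unfolding supp_def
      proof (intro CollectI allI impI)
        fix O' :: "real set" assume O': "open O' \<and> t \<in> O'"
        have op: "open ({0<..<1} \<inter> T -` O')" using T_cont O' by (simp add: continuous_on_open_vimage Int_commute)
        have "w \<in> {0<..<1} \<inter> T -` O'" using w O' by auto
        then have "\<not> negligible ({0<..<1} \<inter> T -` O')"
          using op by (intro open_not_negligible) blast+
        then have "emeasure lborel ({0<..<1} \<inter> T -` O') \<noteq> 0"
          using op by (auto simp: negligible_iff_null_sets null_sets_def)
        then show "0 < emeasure \<nu> O'" using O' by (simp add: \<nu>_emeasure zero_less_iff_neq_zero)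
      qed
    qed
    moreover have "supp \<nu> \<subseteq> closure S"
    proof (rule subsetI, rule ccontr)
      fix t assume t: "t \<in> supp \<nu>" "t \<notin> closure S"
      have "open (- closure S)" by auto
      with t have "0 < emeasure \<nu> (- closure S)" unfolding supp_def by blast
      moreover have "{0<..<1} \<inter> T -` (- closure S) = {}"
        using closure_subset[of S] by (auto simp: S_def)
      ultimately show False by (simp add: \<nu>_emeasure)
    qed
    ultimately have "connected (supp \<nu>)" by (rule connected_intermediate_closure[OF S_conn])
    moreover have "absolutely_continuous lborel \<nu>"
      unfolding \<nu>_density by (intro absolutely_continuousI_density) simp
    ultimately show ?thesis unfolding ac_connected_def using \<nu>.real_distribution_axioms by simp
  qed
  ultimately show ?thesis by (intro that[of \<nu>]) (simp_all add: V_def)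
qed

section \<open>Sets of finite perimeter\<close>

text \<open>
  Finiteness of the outer Minkowski content, phrased as a linear bound on the measure of the collar
  of width \<open>e\<close>: collars of unions and intersections lie in unions of collars, so the bound passes
  to both.
\<close>
definition finite_perimeter :: "'a::metric_space measure \<Rightarrow> 'a set \<Rightarrow> bool" where
  "finite_perimeter M A \<longleftrightarrow> A \<in> sets borel \<and>
     (\<exists>C. \<exists>d>0. \<forall>e. 0 < e \<and> e < d \<longrightarrow> measure M (nbhd e A - A) \<le> C * e)"

lemma open_nbhd: "open (nbhd e A)"
  unfolding nbhd_def by auto

lemma subset_nbhd: "0 < e \<Longrightarrow> A \<subseteq> nbhd e A"
  unfolding nbhd_def by auto

lemma borel_nbhd [measurable, simp]: "nbhd e A \<in> sets borel"
  by (simp add: open_nbhd)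

lemma finite_perimeter_borel: "finite_perimeter M A \<Longrightarrow> A \<in> sets borel"
  by (simp add: finite_perimeter_def)

lemma finite_perimeter_empty: "finite_perimeter M {}"
  unfolding finite_perimeter_def nbhd_def by (auto intro!: exI[of _ 1])

context mm_space
begin

lemma measure_nbhd_diff:
  assumes "A \<in> sets borel" "0 < e"
  shows "measure M (nbhd e A) - measure M A = measure M (nbhd e A - A)"
  using assms subset_nbhd by (subst finite_measure_Diff) (auto simp: sets_eq_borel)

lemma finite_perimeter_of_subset:
  assumes "finite_perimeter M A" "finite_perimeter M B" and Z: "Z \<in> sets borel"
    and sub: "\<And>e. 0 < e \<Longrightarrow> nbhd e Z - Z \<subseteq> (nbhd e A - A) \<union> (nbhd e B - B)"
  shows "finite_perimeter M Z"
proof -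
  obtain C1 d1 where 1: "d1 > 0" "\<And>e. 0 < e \<Longrightarrow> e < d1 \<Longrightarrow> measure M (nbhd e A - A) \<le> C1 * e"
    using assms(1) unfolding finite_perimeter_def by metis
  obtain C2 d2 where 2: "d2 > 0" "\<And>e. 0 < e \<Longrightarrow> e < d2 \<Longrightarrow> measure M (nbhd e B - B) \<le> C2 * e"
    using assms(2) unfolding finite_perimeter_def by metis
  have AB: "A \<in> sets M" "B \<in> sets M" using assms(1,2) by (auto simp: finite_perimeter_def sets_eq_borel)
  have "measure M (nbhd e Z - Z) \<le> (C1 + C2) * e" if e: "0 < e" "e < min d1 d2" for e
  proof -
    have "measure M (nbhd e Z - Z) \<le> measure M ((nbhd e A - A) \<union> (nbhd e B - B))"
      using sub e AB by (intro finite_measure_mono) (auto simp: sets_eq_borel)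
    also have "\<dots> \<le> measure M (nbhd e A - A) + measure M (nbhd e B - B)"
      using AB by (intro measure_Un_le) (auto simp: sets_eq_borel)
    also have "\<dots> \<le> C1 * e + C2 * e" using 1(2) 2(2) e by (intro add_mono) auto
    finally show ?thesis by (simp add: distrib_right)
  qed
  moreover have "min d1 d2 > 0" using 1(1) 2(1) by simp
  ultimately show ?thesis unfolding finite_perimeter_def using Z by blast
qed

lemma finite_perimeter_Un:
  assumes "finite_perimeter M A" "finite_perimeter M B"
  shows "finite_perimeter M (A \<union> B)"
  using assms by (rule finite_perimeter_of_subset)
    (use assms in \<open>auto dest: finite_perimeter_borel simp: nbhd_def\<close>)

lemma finite_perimeter_Int:
  assumes "finite_perimeter M A" "finite_perimeter M B"
  shows "finite_perimeter M (A \<inter> B)"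
  using assms by (rule finite_perimeter_of_subset)
    (use assms in \<open>auto dest: finite_perimeter_borel simp: nbhd_def\<close>)

lemma boundary_measure_finite:
  assumes "finite_perimeter M A"
  shows "boundary_measure M A < \<infinity>"
proof -
  obtain C d where Cd: "d > 0" "\<And>e. 0 < e \<Longrightarrow> e < d \<Longrightarrow> measure M (nbhd e A - A) \<le> C * e"
    using assms unfolding finite_perimeter_def by metis
  have "boundary_measure M A \<le> ennreal C"
    unfolding boundary_measure_def
  proof (rule Limsup_bounded, unfold eventually_at_right_field, intro exI[of _ d] conjI allI impI)
    fix e :: real assume e: "0 < e" "e < d"
    have "(measure M (nbhd e A) - measure M A) / e \<le> C"
      using Cd(2)[OF e] e assms by (simp add: measure_nbhd_diff finite_perimeter_borel divide_le_eq)
    then show "ennreal ((measure M (nbhd e A) - measure M A) / e) \<le> ennreal C" by (rule ennreal_leI)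
  qed (rule Cd)
  then show ?thesis by (simp add: order.strict_trans1)
qed

lemma borel_measurable_lipschitz:
  fixes f :: "'a \<Rightarrow> real"
  assumes "\<And>x y. \<bar>f x - f y\<bar> \<le> dist x y"
  shows "f \<in> borel_measurable borel"
proof -
  have "1-lipschitz_on UNIV f" using assms by (intro lipschitz_onI) (auto simp: dist_real_def)
  then show ?thesis by (intro borel_measurable_continuous_onI lipschitz_on_continuous_on)
qed

lemma measure_distr_borel:
  assumes "f \<in> borel_measurable borel" "X \<in> sets borel"
  shows "measure (distr M borel f) X = measure M (f -` X)"
  using assms by (subst measure_distr) (auto simp: sets_eq_borel measurable_cong_sets[OF sets_eq_borel refl] sets_eq_imp_space_eq[OF sets_eq_borel])

text \<open>
  A 1-Lipschitz function maps the collar of width \<open>e\<close> around a half-space \<open>{f \<le> p}\<close> or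
  \<open>{f > p}\<close> into the interval of radius \<open>e\<close> around \<open>p\<close>.
\<close>
lemma finite_perimeter_level_sets:
  fixes f :: "'a \<Rightarrow> real"
  assumes lip: "\<And>x y. \<bar>f x - f y\<bar> \<le> dist x y"
    and growth: "\<And>h. 0 < h \<Longrightarrow> measure (distr M borel f) (cball p h) \<le> C * h"
  shows "finite_perimeter M {x. f x \<le> p}" "finite_perimeter M {x. p < f x}"
proof -
  have f[measurable]: "f \<in> borel_measurable borel" by (rule borel_measurable_lipschitz[OF lip])
  have *: "measure M (nbhd e A - A) \<le> C * e" if "0 < e" "nbhd e A - A \<subseteq> f -` cball p e" for e A
  proof -
    have "measure M (nbhd e A - A) \<le> measure M (f -` cball p e)"
      using that measurable_sets[OF f, of "cball p e"] by (intro finite_measure_mono) (auto simp: sets_eq_borel)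
    also have "\<dots> = measure (distr M borel f) (cball p e)" by (subst measure_distr_borel) auto
    also have "\<dots> \<le> C * e" using that by (intro growth)
    finally show ?thesis .
  qed
  have near: "\<exists>y\<in>A. \<bar>f y - f x\<bar> < e" if "x \<in> nbhd e A" for x e A
    using that lip by (auto simp: nbhd_def intro: order.strict_trans1)
  have "nbhd e {x. f x \<le> p} - {x. f x \<le> p} \<subseteq> f -` cball p e" for e
    using near[of _ e "{x. f x \<le> p}"] by (fastforce simp: dist_real_def)
  then show "finite_perimeter M {x. f x \<le> p}"
    unfolding finite_perimeter_def using * by (intro conjI exI[of _ C] exI[of _ 1]) auto
  have "nbhd e {x. p < f x} - {x. p < f x} \<subseteq> f -` cball p e" for e
    using near[of _ e "{x. p < f x}"] by (fastforce simp: dist_real_def)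
  then show "finite_perimeter M {x. p < f x}"
    unfolding finite_perimeter_def using * by (intro conjI exI[of _ C] exI[of _ 1]) auto
qed

lemma finite_borel_measure_distr:
  "f \<in> borel_measurable borel \<Longrightarrow> finite_borel_measure (distr M borel f)"
  by (intro finite_borel_measureI finite_measure_distr)
    (auto simp: measurable_cong_sets[OF sets_eq_borel refl])

text \<open>
  The closed neighbourhoods of \<open>C\<close> shrink to \<open>C\<close>, and arbitrarily small radii are radii
  of linear growth for the distance to \<open>C\<close>.
\<close>
lemma ex_finite_perimeter_superset:
  assumes C: "closed C" and e: "e > 0"
  obtains A where "finite_perimeter M A" "C \<subseteq> A" "measure M A < measure M C + e"
proof (cases "C = {}")
  case True
  with e show ?thesis by (intro that[of "{}"] finite_perimeter_empty) auto
next
  case False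
  define f where "f x = infdist x C" for x
  have lip: "\<bar>f x - f y\<bar> \<le> dist x y" for x y
    unfolding f_def by (rule infdist_triangle_abs)
  have f[measurable]: "f \<in> borel_measurable borel" by (rule borel_measurable_lipschitz[OF lip])
  have "(\<lambda>n. measure M {x. f x \<le> 1 / Suc n}) \<longlonglongrightarrow> measure M (\<Inter>n. {x. f x \<le> 1 / Suc n})"
    by (intro finite_Lim_measure_decseq)
      (auto simp: sets_eq_borel decseq_def intro: order_trans simp: frac_le)
  also have "(\<Inter>n. {x. f x \<le> 1 / Suc n}) = C"
  proof (intro equalityI subsetI)
    fix x assume x: "x \<in> (\<Inter>n. {x. f x \<le> 1 / Suc n})"
    have "f x \<le> 0"
    proof (rule field_le_epsilon)
      fix d :: real assume "0 < d"
      then obtain n where "1 / real (Suc n) < d" by (rule nat_approx_posE)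
      with x show "f x \<le> 0 + d" by (auto intro: order_trans less_imp_le)
    qed
    then have "f x = 0" using infdist_nonneg[of x C] by (simp add: f_def)
    then show "x \<in> C" using C False by (simp add: f_def in_closed_iff_infdist_zero)
  qed (simp add: f_def)
  finally have "eventually (\<lambda>n. measure M {x. f x \<le> 1 / Suc n} < measure M C + e) sequentially"
    using e by (intro order_tendstoD(2)) auto
  then obtain n where n: "measure M {x. f x \<le> 1 / Suc n} < measure M C + e"
    by (auto simp: eventually_sequentially)
  obtain L K where K: "K \<subseteq> {0..1 / Suc n}" "emeasure lborel K > 0"
    "\<And>t h. t \<in> K \<Longrightarrow> 0 < h \<Longrightarrow> measure (distr M borel f) (cball t h) \<le> L * h"
    using ex_linear_growth_set[OF finite_borel_measure_distr[OF f], of 0 "1 / Suc n"]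
    by (metis of_nat_0_less_iff zero_less_Suc zero_less_divide_1_iff)
  from K(2) have "K \<noteq> {}" by auto
  then obtain t where t: "t \<in> K" by blast
  show ?thesis
  proof (rule that[of "{x. f x \<le> t}"])
    show "finite_perimeter M {x. f x \<le> t}"
      by (rule finite_perimeter_level_sets(1)[OF lip K(3)[OF t]])
    show "C \<subseteq> {x. f x \<le> t}" using t K(1) by (auto simp: f_def)
    have "measure M {x. f x \<le> t} \<le> measure M {x. f x \<le> 1 / Suc n}"
      using t K(1) by (intro finite_measure_mono) (auto simp: sets_eq_borel)
    with n show "measure M {x. f x \<le> t} < measure M C + e" by simp
  qed
qed

lemma boundary_measure_ge_cheeger:
  assumes A: "A \<in> sets borel" "0 < measure M A" "measure M A < 1" and c: "0 \<le> c" "ennreal c \<le> cheeger M"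
  shows "ennreal (c * min (measure M A) (1 - measure M A)) \<le> boundary_measure M A"
proof -
  define m where "m = min (measure M A) (1 - measure M A)"
  have m: "m > 0" using A by (simp add: m_def)
  have "measure M (- A) = 1 - measure M A"
    using prob_compl[of A] A by (simp add: sets_eq_borel Compl_eq_Diff_UNIV sets_eq_imp_space_eq[OF sets_eq_borel])
  then have "ennreal c \<le> boundary_measure M A / ennreal m"
    using c(2) A unfolding cheeger_def m_def by (auto simp: le_INF_iff)
  then have "ennreal (c * m) \<le> boundary_measure M A"
    using m c(1) by (cases "boundary_measure M A")
      (auto simp: divide_ennreal le_divide_eq split: if_splits)
  then show ?thesis by (simp add: m_def)
qed

end

text \<open>
  A monotone function whose upper right derivative is at least \<open>k\<close> everywhere has slope at least
  \<open>k\<close>: for \<open>l < k\<close>, the last point up to which slope \<open>l\<close> is kept must be the right end.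
\<close>
lemma increment_ge_of_upper_derivative_ge:
  fixes F :: "real \<Rightarrow> real"
  assumes mono: "\<And>s t. s \<le> t \<Longrightarrow> F s \<le> F t"
    and steep: "\<And>t l d. a \<le> t \<Longrightarrow> t < b \<Longrightarrow> l < k \<Longrightarrow> 0 < d \<Longrightarrow> \<exists>e>0. e < d \<and> l * e \<le> F (t + e) - F t"
    and xy: "a \<le> x" "x \<le> y" "y \<le> b"
  shows "k * (y - x) \<le> F y - F x"
proof -
  have bound: "l * (y - x) \<le> F y - F x" if l: "0 \<le> l" "l < k" for l
  proof -
    define S where "S = {t\<in>{x..y}. l * (t - x) \<le> F t - F x}"
    define s where "s = Sup S"
    have xS: "x \<in> S" using xy by (simp add: S_def)
    have bdd: "bdd_above S" by (auto simp: S_def bdd_above_def)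
    have s: "x \<le> s" "s \<le> y"
      using xS bdd by (auto simp: s_def S_def intro!: cSup_upper cSup_least)
    have "l * (s - x) \<le> F s - F x"
    proof (rule field_le_epsilon)
      fix d :: real assume d: "0 < d"
      obtain t where t: "t \<in> S" "s - d / (l + 1) < t"
        using less_cSup_iff[of S "s - d / (l + 1)"] xS bdd d l by (auto simp: s_def)
      have ts: "t \<le> s" using t bdd by (auto simp: s_def intro: cSup_upper)
      have "s - t \<le> d / (l + 1)" using t by simp
      then have "l * (s - t) \<le> l * (d / (l + 1))" using l by (intro mult_left_mono) auto
      also have "\<dots> \<le> d" using l d by (simp add: field_simps)
      finally have "l * (s - x) \<le> l * (t - x) + d" by (simp add: algebra_simps)
      also have "l * (t - x) \<le> F t - F x" using t by (simp add: S_def)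
      also have "F t \<le> F s" using ts by (rule mono)
      finally show "l * (s - x) \<le> F s - F x + d" by simp
    qed
    then have sS: "s \<in> S" using s by (simp add: S_def)
    have "s = y"
    proof (rule ccontr)
      assume "s \<noteq> y"
      with s have "s < y" by simp
      with xy s steep[of s l "y - s"] l obtain e where e: "e > 0" "e < y - s" "l * e \<le> F (s + e) - F s" by auto
      have "s + e \<in> S" using sS e s by (auto simp: S_def algebra_simps)
      then have "s + e \<le> s" unfolding s_def using bdd by (rule cSup_upper)
      with e show False by simp
    qed
    with sS show ?thesis by (simp add: S_def)
  qed
  show ?thesis
  proof (cases "k \<le> 0 \<or> x = y")
    case True
    then have "k * (y - x) \<le> 0" using xy by (auto simp: mult_nonpos_nonneg)
    with mono[OF xy(2)] show ?thesis by simp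
  next
    case False
    show ?thesis
    proof (rule field_le_mult_one_interval)
      fix z :: real assume z: "0 < z" "z < 1"
      then show "z * (k * (y - x)) \<le> F y - F x"
        using bound[of "z * k"] False by (simp add: mult.assoc)
    qed
  qed
qed

context mm_space
begin

text \<open>
  The sublevel sets of a 1-Lipschitz function are test sets for the Cheeger constant, and their
  \<open>e\<close>-neighbourhoods lie in sublevel sets of level raised by \<open>e\<close>. So the distribution
  function has an upper derivative bounded below wherever it stays away from 0 and 1.
\<close>
lemma cdf_distr_steep:
  fixes f :: "'a \<Rightarrow> real"
  assumes lip: "\<And>x y. \<bar>f x - f y\<bar> \<le> dist x y" and ch: "0 < cheeger M"
    and ab: "a < b" "0 < cdf (distr M borel f) a" "cdf (distr M borel f) b < 1"
  obtains k where "k > 0"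
    "\<And>x y. a \<le> x \<Longrightarrow> x \<le> y \<Longrightarrow> y \<le> b \<Longrightarrow>
       k * (y - x) \<le> cdf (distr M borel f) y - cdf (distr M borel f) x"
proof -
  define F where "F = cdf (distr M borel f)"
  have f[measurable]: "f \<in> borel_measurable borel" by (rule borel_measurable_lipschitz[OF lip])
  interpret N: finite_borel_measure "distr M borel f" by (rule finite_borel_measure_distr[OF f])
  have F_eq: "F t = measure M {x. f x \<le> t}" for t
    unfolding F_def cdf_def by (subst measure_distr_borel) (auto simp: vimage_def)
  obtain c where c: "0 < c" "ennreal c \<le> cheeger M"
    using ch by (cases "cheeger M") (auto intro: that[of 1] that simp: ennreal_less_zero_iff)
  define k where "k = c * min (F a) (1 - F b)"
  have k: "k > 0" using c ab by (simp add: k_def F_def)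
  have mono: "F s \<le> F t" if "s \<le> t" for s t unfolding F_def using that by (rule N.cdf_nondecreasing)
  have steep: "\<exists>e>0. e < d \<and> l * e \<le> F (t + e) - F t" if t: "a \<le> t" "t < b" "l < k" "0 < d" for t l d
  proof (rule ccontr)
    assume neg: "\<not> ?thesis"
    define A where "A = {x. f x \<le> t}"
    have A[measurable]: "A \<in> sets borel" unfolding A_def by measurable
    have At: "measure M A = F t" by (simp add: A_def F_eq)
    have "F a \<le> F t" "F t \<le> F b" using t mono by auto
    then have "k \<le> c * min (F t) (1 - F t)" unfolding k_def using c by (intro mult_left_mono) auto
    then have "ennreal k \<le> boundary_measure M A"
      using boundary_measure_ge_cheeger[of A c] c ab At \<open>F a \<le> F t\<close> \<open>F t \<le> F b\<close>
      by (auto simp: F_def[symmetric] intro: order_trans[OF ennreal_leI])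
    also have "\<dots> \<le> ennreal l"
      unfolding boundary_measure_def
    proof (rule Limsup_bounded, unfold eventually_at_right_field, intro exI[of _ d] conjI allI impI)
      fix e :: real assume e: "0 < e" "e < d"
      have "nbhd e A \<subseteq> {x. f x \<le> t + e}"
      proof
        fix x assume "x \<in> nbhd e A"
        then obtain y where "f y \<le> t" "dist y x < e" by (auto simp: nbhd_def A_def)
        with lip[of x y] show "x \<in> {x. f x \<le> t + e}" by (auto simp: dist_commute)
      qed
      then have "measure M (nbhd e A) \<le> F (t + e)"
        unfolding F_eq by (intro finite_measure_mono) (auto simp: sets_eq_borel)
      also have "F (t + e) - F t < l * e" using neg e by (auto simp: not_le)
      then have "F (t + e) \<le> l * e + measure M A" by (simp add: At)
      finally have "(measure M (nbhd e A) - measure M A) / e \<le> l" using e by (simp add: divide_le_eq)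
      then show "ennreal ((measure M (nbhd e A) - measure M A) / e) \<le> ennreal l" by (rule ennreal_leI)
    qed (rule t)
    finally have "k \<le> max 0 l" using k by (simp add: ennreal_le_iff2 max_def split: if_splits)
    with t k show False by (simp add: max_def split: if_splits)
  qed
  show ?thesis
    using increment_ge_of_upper_derivative_ge[of F a b k, OF mono steep] k
    by (intro that[of k]) (auto simp: F_def)
qed

end

section \<open>Finiteness of the isoperimetric profile\<close>

lemma measure_singleton_growth_zero:
  assumes N: "finite_borel_measure N" and growth: "\<And>h. 0 < h \<Longrightarrow> measure N (cball t h) \<le> C * h"
  shows "measure N {t} = 0"
proof -
  interpret N: finite_borel_measure N by fact
  have "measure N {t} \<le> 0 + d" if d: "0 < d" for d
  proof -
    have "measure N {t} \<le> measure N (cball t (d / (\<bar>C\<bar> + 1)))"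
      using d by (intro N.finite_measure_mono) (auto simp: N.M_is_borel)
    also have "\<dots> \<le> C * (d / (\<bar>C\<bar> + 1))" using d by (intro growth) simp
    also have "\<dots> \<le> (\<bar>C\<bar> + 1) * (d / (\<bar>C\<bar> + 1))" using d by (intro mult_right_mono) auto
    also have "\<dots> = d" by simp
    finally show ?thesis by simp
  qed
  then have "measure N {t} \<le> 0" by (rule field_le_epsilon)
  then show ?thesis by (simp add: order_antisym)
qed

text \<open>
  A form of the density theorem: if \<open>K\<close> filled at most the fraction 3/4 of every interval, the
  comparison of measures on intervals would extend to \<open>K\<close> itself and give \<open>measure N K \<le> 3/4 * measure N K\<close>.
\<close>
lemma ex_interval_mostly_in:
  assumes N: "finite_borel_measure N" and K: "K \<in> sets borel" "measure N K > 0"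
  obtains p q where "p < q" "measure N (K \<inter> {p<..q}) > 3 / 4 * measure N {p<..q}"
proof (rule ccontr)
  assume "\<not> thesis"
  with that have le: "measure N (K \<inter> {p<..q}) \<le> 3 / 4 * measure N {p<..q}" if "p < q" for p q
    using \<open>p < q\<close> by (meson not_le)
  interpret N: finite_borel_measure N by fact
  define N1 where "N1 = scale_measure 4 (density N (indicator K))"
  define N2 where "N2 = scale_measure 3 N"
  have N1: "emeasure N1 X = ennreal (4 * measure N (K \<inter> X))" if "X \<in> sets borel" for X
    using that K unfolding N1_def
    by (simp add: emeasure_restricted N.M_is_borel N.emeasure_eq_measure ennreal_mult')
  have N2: "emeasure N2 X = ennreal (3 * measure N X)" for X
    unfolding N2_def by (simp add: N.emeasure_eq_measure ennreal_mult')
  have "measure N1 K \<le> measure N2 K"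
  proof (rule measure_le_of_Ioc_le[OF _ _ _ K(1)])
    show "finite_borel_measure N1" using N1[of UNIV]
      by (intro finite_borel_measureI finite_measureI) (auto simp: N1_def N.M_is_borel N.borel_UNIV space_scale_measure)
    show "finite_borel_measure N2" using N2[of UNIV]
      by (intro finite_borel_measureI finite_measureI) (auto simp: N2_def N.M_is_borel N.borel_UNIV space_scale_measure)
    show "measure N1 {a<..b} \<le> measure N2 {a<..b}" if "a < b" for a b
      using le[OF that] by (simp add: measure_def[of N1] measure_def[of N2] N1 N2)
  qed
  with K show False by (simp add: measure_def[of N1] measure_def[of N2] N1 N2)
qed

text \<open>
  A distribution function with slope bounded below dominates a multiple of Lebesgue measure, so it
  charges the set of points of linear growth. Shrinking an interval in which this set has a large
  share to the extreme points of the set makes the end points points of linear growth as well.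
\<close>
lemma ex_mostly_growth_interval:
  assumes N: "finite_borel_measure N" and ab: "a < b" and k: "k > 0"
    and steep: "\<And>x y. a \<le> x \<Longrightarrow> x \<le> y \<Longrightarrow> y \<le> b \<Longrightarrow> k * (y - x) \<le> cdf N y - cdf N x"
  obtains C K y z where "compact K" "K \<subseteq> {y..z}" "y \<in> K" "z \<in> K" "y < z"
    "\<And>t h. t \<in> K \<Longrightarrow> 0 < h \<Longrightarrow> measure N (cball t h) \<le> C * h"
    "measure N K > 3 / 4 * measure N {y<..z}"
proof -
  interpret N: finite_borel_measure N by fact
  obtain C K where K: "compact K" "K \<subseteq> {a..b}" "emeasure lborel K > 0"
    and growth: "\<And>t h. t \<in> K \<Longrightarrow> 0 < h \<Longrightarrow> measure N (cball t h) \<le> C * h"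
    by (rule ex_linear_growth_set[OF N ab]) (rule that)
  have K_borel: "K \<in> sets borel" using K(1) by (rule borel_compact)
  have atom: "measure N {t} = 0" if "t \<in> K" for t
    using growth[OF that] by (rule measure_singleton_growth_zero[OF N])
  have "measure N K > 0"
  proof -
    define L where "L = scale_measure (ennreal k) (density lborel (indicator {a<..b}))"
    have L: "emeasure L X = ennreal k * emeasure lborel ({a<..b} \<inter> X)" if "X \<in> sets borel" for X
      using that unfolding L_def by (simp add: emeasure_restricted)
    have L_fin: "finite_borel_measure L" using L[of UNIV] ab
      by (intro finite_borel_measureI finite_measureI) (auto simp: L_def space_scale_measure ennreal_mult_eq_top_iff)
    have "measure L K \<le> measure N K"
    proof (rule measure_le_of_Ioc_le[OF L_fin N _ K_borel])
      fix p q :: real assume pq: "p < q"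
      define x y where "x = max a p" and "y = min b q"
      have I: "{a<..b} \<inter> {p<..q} = {x<..y}" by (auto simp: x_def y_def)
      have L_pq: "emeasure L {p<..q} = ennreal k * emeasure lborel {x<..y}"
        using L[of "{p<..q}"] unfolding I by simp
      show "measure L {p<..q} \<le> measure N {p<..q}"
      proof (cases "x < y")
        case True
        then have "measure L {p<..q} = k * (y - x)"
          using k by (simp add: measure_def L_pq ennreal_mult[symmetric])
        also have "\<dots> \<le> cdf N y - cdf N x" using True by (intro steep) (auto simp: x_def y_def)
        also have "\<dots> = measure N {x<..y}" using True by (rule N.cdf_diff_eq)
        also have "\<dots> \<le> measure N {p<..q}"
          unfolding I[symmetric] by (intro N.finite_measure_mono) (auto simp: N.M_is_borel)
        finally show ?thesis .
      next
        case False
        then show ?thesis by (simp add: measure_def[of L] L_pq)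
      qed
    qed
    moreover have "measure L K > 0"
    proof -
      interpret L: finite_borel_measure L by (rule L_fin)
      have "emeasure lborel ({a<..b} \<inter> K) = emeasure lborel K"
      proof (rule emeasure_eq_AE)
        show "AE x in lborel. x \<in> {a<..b} \<inter> K \<longleftrightarrow> x \<in> K"
          using AE_lborel_singleton[of a] by eventually_elim (use K(2) in auto)
      qed (use K_borel in auto)
      then have "emeasure L K > 0" using K(3) k K_borel by (simp add: L ennreal_zero_less_mult_iff)
      then show ?thesis by (simp add: L.emeasure_eq_measure)
    qed
    ultimately show ?thesis by simp
  qed
  then obtain p q where pq: "p < q" "measure N (K \<inter> {p<..q}) > 3 / 4 * measure N {p<..q}"
    using ex_interval_mostly_in[OF N K_borel] by blast
  define Q where "Q = K \<inter> {p<..q}"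
  have Q_pos: "measure N Q > 0"
    using pq(2) measure_nonneg[of N "{p<..q}"] unfolding Q_def by linarith
  then have Q_ne: "Q \<noteq> {}" by auto
  define y z where "y = Inf Q" and "z = Sup Q"
  have "bounded Q" using compact_imp_bounded[OF K(1)] by (rule bounded_subset) (auto simp: Q_def)
  then have bdd: "bdd_below Q" "bdd_above Q" by (auto intro: bounded_imp_bdd_below bounded_imp_bdd_above)
  have "closure Q \<subseteq> K" using compact_imp_closed[OF K(1)] by (intro closure_minimal) (auto simp: Q_def)
  then have yz: "y \<in> K" "z \<in> K"
    using closure_contains_Inf[OF Q_ne bdd(1)] closure_contains_Sup[OF Q_ne bdd(2)] by (auto simp: y_def z_def)
  have Q_sub: "Q \<subseteq> {y..z}" using bdd by (auto simp: y_def z_def intro: cInf_lower cSup_upper)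
  have "p \<le> y" unfolding y_def using Q_ne by (rule cInf_greatest) (simp add: Q_def)
  have "z \<le> q" unfolding z_def using Q_ne by (rule cSup_least) (simp add: Q_def)
  define K' where "K' = K \<inter> {y..z}"
  have QK': "Q \<subseteq> K'" using Q_sub by (auto simp: K'_def Q_def)
  have K'_borel: "K' \<in> sets borel" using K_borel by (simp add: K'_def)
  have Q_le: "measure N Q \<le> measure N K'"
    using QK' K'_borel by (intro N.finite_measure_mono) (auto simp: N.M_is_borel)
  have "y < z"
  proof (rule ccontr)
    assume "\<not> y < z"
    then have "K' \<subseteq> {y}" by (auto simp: K'_def)
    then have "measure N K' \<le> measure N {y}" by (intro N.finite_measure_mono) (auto simp: N.M_is_borel)
    with atom[OF yz(1)] Q_le Q_pos show False by simp
  qed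
  moreover have "measure N {y<..z} \<le> measure N {p<..q}"
    using \<open>p \<le> y\<close> \<open>z \<le> q\<close> by (intro N.finite_measure_mono) (auto simp: N.M_is_borel)
  then have "measure N K' > 3 / 4 * measure N {y<..z}"
    using pq(2) Q_le by (simp add: Q_def)
  moreover have "compact K'" unfolding K'_def using K(1) by (intro compact_Int_closed) auto
  ultimately show ?thesis
    using yz growth by (intro that[of K' y z C]) (auto simp: K'_def)
qed

text \<open>
  A Steinhaus argument. The distribution function \<open>F\<close> is continuous on \<open>K\<close>, and its image
  \<open>E = F ` K\<close> is a compact subset of an interval of length \<open>L\<close> with Lebesgue measure at
  least \<open>measure N K\<close>. If \<open>E\<close> and its translate by \<open>d\<close> were disjoint, an interval of
  length \<open>L + d\<close> would contain two copies of \<open>E\<close>, which is too much.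
\<close>
lemma ex_cdf_difference:
  assumes N: "finite_borel_measure N" and K: "compact K" "K \<subseteq> {y..z}"
    and atom: "\<And>t. t \<in> K \<Longrightarrow> measure N {t} = 0"
    and d: "0 \<le> d" "d < 2 * measure N K - measure N {y<..z}" and yz: "y < z"
  obtains s t where "s \<in> K" "t \<in> K" "cdf N t - cdf N s = d"
proof -
  interpret N: finite_borel_measure N by fact
  define F where "F = cdf N"
  have F_mono: "F s \<le> F t" if "s \<le> t" for s t unfolding F_def using that by (rule N.cdf_nondecreasing)
  have F[measurable]: "F \<in> borel_measurable borel" by (intro borel_measurable_mono monoI F_mono)
  have K_borel[measurable]: "K \<in> sets borel" using K(1) by (rule borel_compact)
  have F_cont: "continuous_on K F"
    unfolding F_def using atom N.isCont_cdf by (auto intro!: continuous_at_imp_continuous_on)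
  define E where "E = F ` K"
  have E: "compact E" unfolding E_def using F_cont K(1) by (rule compact_continuous_image)
  have E_borel[measurable]: "E \<in> sets borel" using E by (rule borel_compact)
  have E_sub: "E \<subseteq> {F y..F z}" using K(2) F_mono by (auto simp: E_def)
  define L where "L = F z - F y"
  have L: "L = measure N {y<..z}" unfolding L_def F_def using yz by (rule N.cdf_diff_eq)
  have E_large: "measure N K \<le> measure lborel E"
  proof -
    \<comment> \<open>Lowering the left end by 1 puts \<open>F y\<close> itself into the half-open interval.\<close>
    define I where "I = {F y - 1<..F z}"
    define N1 where "N1 = distr (density N (indicator K)) borel F"
    define N2 where "N2 = density lborel (indicator I :: real \<Rightarrow> ennreal)"
    have N1: "emeasure N1 X = ennreal (measure N (K \<inter> F -` X))" if [measurable]: "X \<in> sets borel" for X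
    proof -
      have "F -` X \<in> sets borel" using measurable_sets[OF F that] by simp
      moreover have "F \<in> borel_measurable (density N (indicator K))"
        using F by (simp add: measurable_cong_sets[OF N.M_is_borel refl])
      ultimately show ?thesis unfolding N1_def
        by (subst emeasure_distr) (auto simp: emeasure_restricted N.M_is_borel N.borel_UNIV N.emeasure_eq_measure)
    qed
    have N2: "emeasure N2 X = emeasure lborel (I \<inter> X)" if "X \<in> sets borel" for X
      using that unfolding N2_def I_def by (subst emeasure_restricted) auto
    have "measure N1 E \<le> measure N2 E"
    proof (rule measure_le_of_Ioc_le[OF _ _ _ E_borel])
      show "finite_borel_measure N1" using N1[of UNIV]
        by (intro finite_borel_measureI finite_measureI) (auto simp: N1_def)
      show "finite_borel_measure N2" using N2[of UNIV] F_mono[of y z] yz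
        by (intro finite_borel_measureI finite_measureI) (auto simp: N2_def I_def)
      fix p q :: real assume pq: "p < q"
      define Q where "Q = K \<inter> F -` {p<..q}"
      show "measure N1 {p<..q} \<le> measure N2 {p<..q}"
      proof (cases "Q = {}")
        case True then show ?thesis by (simp add: measure_def[of N1] N1 Q_def)
      next
        case False
        define l u where "l = Inf Q" and "u = Sup Q"
        have "bounded Q" using compact_imp_bounded[OF K(1)] by (rule bounded_subset) (auto simp: Q_def)
        then have bdd: "bdd_below Q" "bdd_above Q" by (auto intro: bounded_imp_bdd_below bounded_imp_bdd_above)
        have cl: "l \<in> closure Q" "u \<in> closure Q"
          using closure_contains_Inf[OF False bdd(1)] closure_contains_Sup[OF False bdd(2)] by (auto simp: l_def u_def)
        have "closed (K \<inter> F -` {p..q})"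
          using F_cont compact_imp_closed[OF K(1)] by (intro continuous_closed_preimage) auto
        then have "closure Q \<subseteq> K \<inter> F -` {p..q}" by (intro closure_minimal) (auto simp: Q_def)
        with cl have lu: "l \<in> K" "p \<le> F l" "u \<in> K" "F u \<le> q" by auto
        have Q_sub: "Q \<subseteq> {l..u}" using bdd by (auto simp: l_def u_def intro: cInf_lower cSup_upper)
        have "F y \<le> F l" "F u \<le> F z" using lu K(2) F_mono by auto
        have "l \<le> u" using Q_sub False by fastforce
        have "measure N Q \<le> measure N {l..u}"
          using Q_sub by (intro N.finite_measure_mono) (auto simp: N.M_is_borel)
        also have "{l..u} = {l} \<union> {l<..u}" using \<open>l \<le> u\<close> by auto
        also have "measure N \<dots> \<le> measure N {l} + measure N {l<..u}"
          by (intro measure_Un_le) (auto simp: N.M_is_borel)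
        also have "\<dots> = F u - F l"
          using atom[OF lu(1)] \<open>l \<le> u\<close> N.cdf_diff_eq[of l u] by (cases "l = u") (auto simp: F_def)
        also have "\<dots> = measure lborel {F l<..F u}" using F_mono[OF \<open>l \<le> u\<close>] by simp
        also have "\<dots> \<le> measure lborel (I \<inter> {p<..q})"
        proof (rule measure_mono_fmeasurable)
          show "{F l<..F u} \<subseteq> I \<inter> {p<..q}" using lu \<open>F y \<le> F l\<close> \<open>F u \<le> F z\<close> by (auto simp: I_def)
          have "bounded (I \<inter> {p<..q})" unfolding I_def by (intro bounded_Int) auto
          then show "I \<inter> {p<..q} \<in> fmeasurable lborel"
            by (intro fmeasurableI emeasure_bounded_finite) (auto simp: I_def)
        qed simp
        finally show ?thesis by (simp add: measure_def[of N1] measure_def[of N2] N1 N2 Q_def measure_def[of lborel])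
      qed
    qed
    moreover have "measure N1 E = measure N K"
    proof -
      have "K \<inter> F -` E = K" by (auto simp: E_def)
      then show ?thesis by (simp add: measure_def[of N1] N1)
    qed
    moreover have "measure N2 E = measure lborel E"
    proof -
      have "I \<inter> E = E" using E_sub by (auto simp: I_def)
      then show ?thesis by (simp add: measure_def N2)
    qed
    ultimately show ?thesis by simp
  qed
  have fm: "E \<in> fmeasurable lborel" "(\<lambda>x. d + x) ` E \<in> fmeasurable lborel"
    using E by (auto intro!: fmeasurable_compact compact_translation)
  have "E \<inter> (\<lambda>x. d + x) ` E \<noteq> {}"
  proof
    assume disj: "E \<inter> (\<lambda>x. d + x) ` E = {}"
    have "measure lborel ((\<lambda>x. d + x) ` E) = measure lborel E"
      using measure_translation[of d E] E by (simp add: measure_completion borel_compact compact_translation)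
    moreover have "measure lborel (E \<union> (\<lambda>x. d + x) ` E) = measure lborel E + measure lborel ((\<lambda>x. d + x) ` E)"
      using fm disj by (intro measure_Union) (auto simp: fmeasurable_def)
    moreover have "measure lborel (E \<union> (\<lambda>x. d + x) ` E) \<le> measure lborel {F y..F z + d}"
      using E_sub d fm by (intro measure_mono_fmeasurable fmeasurable_compact) (auto dest: fmeasurableD)
    moreover have "measure lborel {F y..F z + d} = L + d"
      using F_mono[of y z] yz d by (simp add: L_def)
    ultimately show False using E_large d L by simp
  qed
  then obtain s t where "s \<in> K" "t \<in> K" "F t = d + F s" by (auto simp: E_def)
  then show ?thesis by (intro that[of s t]) (simp_all add: F_def)
qed

context mm_space
begin

text \<open>
  Let \<open>f\<close> be the distance from a point and \<open>J\<close> a shell \<open>{y < f \<le> z}\<close> of measure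
  \<open>L\<close> in which the points at a compact set \<open>K\<close> of radii of linear growth form a set \<open>P\<close> of
  measure \<open>c > 3/4 * L\<close>.
  Every \<open>d\<close> strictly between 0 and \<open>L\<close> is the measure of a subset of \<open>J\<close> of finite
  perimeter: Steinhaus' argument provides thinner shells for \<open>d < 2 * c - L\<close>, and their
  complements in \<open>J\<close> give the remaining values because \<open>4 * c > 3 * L\<close>.

  Now let \<open>R\<close> be disjoint from \<open>P\<close> and \<open>0 < s < c\<close>. Outside \<open>J\<close>, the set \<open>R\<close>
  is approximated by a set of finite perimeter. The remaining measure up to \<open>measure M R + s\<close> is
  close to \<open>measure M (R \<inter> J) + s\<close>, which lies strictly between 0 and \<open>L\<close>, so some subset of
  \<open>J\<close> of finite perimeter supplies it exactly. Hence the profile is finite at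
  \<open>measure M R + s\<close>.

  An arbitrary value of \<open>M\<close> has the form \<open>measure M R + s\<close> with \<open>0 \<le> s \<le> c\<close>. The values that
  can be written with \<open>s = 0\<close> or with \<open>s = c\<close>, and at which the profile is infinite, form two
  sets whose distinct points are at distance at least \<open>c\<close>; such sets are countable.
\<close>
lemma finite_profile_off_countable:
  assumes ch: "0 < cheeger M"
  shows "countable {v \<in> Im_measure M. iso_profile M v = \<infinity>}"
proof (cases "\<exists>x0 y0 :: 'a. x0 \<noteq> y0")
  case False
  have "A = {} \<or> A = UNIV" for A :: "'a set"
  proof (cases "A = {}")
    case False
    then obtain a where "a \<in> A" by blast
    moreover have "x = a" for x using \<open>\<nexists>x0 y0 :: 'a. x0 \<noteq> y0\<close> by blast
    ultimately show ?thesis by (metis UNIV_eq_I)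
  qed simp
  then have "Im_measure M \<subseteq> measure M ` {{}, UNIV}" unfolding Im_measure_def by blast
  then have "finite (Im_measure M)" by (rule finite_subset) simp
  then have "countable (Im_measure M)" by (rule countable_finite)
  then show ?thesis by (rule countable_subset[rotated]) auto
next
  case True
  then obtain x0 y0 :: 'a where xy0: "x0 \<noteq> y0" by blast
  define f where "f x = dist x0 x" for x
  have lip: "\<bar>f x - f y\<bar> \<le> dist x y" for x y
    unfolding f_def using dist_triangle[of x0 x y] dist_triangle[of x0 y x] by (simp add: dist_commute abs_le_iff)
  have f[measurable]: "f \<in> borel_measurable borel" by (rule borel_measurable_lipschitz[OF lip])
  define N where "N = distr M borel f"
  have N_fin: "finite_borel_measure N" unfolding N_def by (rule finite_borel_measure_distr[OF f])
  interpret N: finite_borel_measure N by (rule N_fin)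
  have N_eq: "measure N X = measure M (f -` X)" if "X \<in> sets borel" for X
    unfolding N_def using f that by (rule measure_distr_borel)
  have pos: "0 < measure M U" if "open U" "x \<in> U" for U and x :: 'a
  proof -
    have "x \<in> supp M" using full_supp by simp
    then have "0 < emeasure M U" using that unfolding supp_def by blast
    then show ?thesis by (simp add: emeasure_eq_measure)
  qed
  define D where "D = dist x0 y0"
  have D: "D > 0" using xy0 by (simp add: D_def)
  have Fa: "0 < cdf N (D / 3)"
  proof -
    have "0 < measure M (ball x0 (D / 3))" using D by (intro pos[of _ x0]) auto
    also have "\<dots> \<le> cdf N (D / 3)"
      using measurable_sets[OF f, of "{..D/3}"]
      unfolding cdf_def by (subst N_eq) (auto simp: f_def sets_eq_borel intro!: finite_measure_mono)
    finally show ?thesis .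
  qed
  have Fb: "cdf N (D / 2) < 1"
  proof -
    define B where "B = ball y0 (D / 3)"
    have sub: "f -` {..D / 2} \<subseteq> space M - B"
    proof
      fix x assume "x \<in> f -` {..D / 2}"
      then have "dist x0 x \<le> D / 2" by (simp add: f_def)
      moreover have "D \<le> dist x0 x + dist y0 x" unfolding D_def by (metis dist_commute dist_triangle)
      ultimately have "\<not> dist y0 x < D / 3" using D by linarith
      then show "x \<in> space M - B" by (simp add: B_def sets_eq_imp_space_eq[OF sets_eq_borel])
    qed
    have "cdf N (D / 2) \<le> measure M (space M - B)"
      unfolding cdf_def using sub by (subst N_eq) (auto simp: B_def sets_eq_borel intro!: finite_measure_mono)
    also have "\<dots> = 1 - measure M B" by (intro prob_compl) (simp add: B_def sets_eq_borel)
    also have "0 < measure M B" using D unfolding B_def by (intro pos[of _ y0]) auto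
    then have "1 - measure M B < 1" by simp
    finally show ?thesis .
  qed
  \<comment> \<open>Between the radii \<open>D / 3\<close> and \<open>D / 2\<close>, small balls around the two points keep the
    distribution function away from 0 and 1.\<close>
  obtain k where k: "k > 0" "\<And>x y. D / 3 \<le> x \<Longrightarrow> x \<le> y \<Longrightarrow> y \<le> D / 2 \<Longrightarrow> k * (y - x) \<le> cdf N y - cdf N x"
    using cdf_distr_steep[OF lip ch, of "D / 3" "D / 2"] D Fa Fb unfolding N_def by auto
  have D32: "D / 3 < D / 2" using D by simp
  obtain C K y z where K: "compact K" "K \<subseteq> {y..z}" "y \<in> K" "z \<in> K" "y < z"
    and growth: "\<And>t h. t \<in> K \<Longrightarrow> 0 < h \<Longrightarrow> measure N (cball t h) \<le> C * h"
    and large: "measure N K > 3 / 4 * measure N {y<..z}"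
    by (rule ex_mostly_growth_interval[OF N_fin D32 k(1)]) (erule (2) k(2), rule that)
  have atom: "measure N {t} = 0" if "t \<in> K" for t
    using growth[OF that] by (rule measure_singleton_growth_zero[OF N_fin])
  have le_fp: "finite_perimeter M {x. f x \<le> t}" and gt_fp: "finite_perimeter M {x. t < f x}" if "t \<in> K" for t
    using finite_perimeter_level_sets[OF lip growth[OF that, unfolded N_def]] by blast+
  have K_borel: "K \<in> sets borel" using K(1) by (rule borel_compact)
  define J where "J = {x. y < f x \<and> f x \<le> z}"
  have J_borel: "J \<in> sets borel" unfolding J_def by measurable
  define L where "L = measure N {y<..z}"
  have J_meas: "measure M J = L" unfolding L_def J_def by (subst N_eq) (auto intro!: arg_cong[of _ _ "measure M"])
  have shell_fp: "finite_perimeter M {x. s < f x \<and> f x \<le> t}" if "s \<in> K" "t \<in> K" for s t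
    using finite_perimeter_Int[OF gt_fp[OF that(1)] le_fp[OF that(2)]] by (simp add: Int_def)
  have shell_meas: "measure M {x. s < f x \<and> f x \<le> t} = cdf N t - cdf N s" if "s < t" for s t
    using that N.cdf_diff_eq[of s t] by (subst (asm) N_eq) (auto simp: vimage_def greaterThanAtMost_def greaterThan_def atMost_def Int_def)
  have small_values: "\<exists>W. finite_perimeter M W \<and> W \<subseteq> J \<and> measure M W = d \<and> finite_perimeter M (J - W)"
    if d: "0 < d" "d < 2 * measure N K - L" for d
  proof -
    have d': "0 \<le> d" "d < 2 * measure N K - measure N {y<..z}" using d by (simp_all add: L_def)
    obtain s t where st: "s \<in> K" "t \<in> K" "cdf N t - cdf N s = d"
      by (rule ex_cdf_difference[OF N_fin K(1,2) _ d' K(5)]) (erule atom, rule that)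
    have "s < t" using N.cdf_nondecreasing[of t s] st(3) d(1) by (cases "s < t") auto
    define W where "W = {x. s < f x \<and> f x \<le> t}"
    have "y \<le> s" "t \<le> z" using st K(2) by auto
    then have "W \<subseteq> J" by (auto simp: W_def J_def)
    moreover have "J - W = {x. y < f x \<and> f x \<le> s} \<union> {x. t < f x \<and> f x \<le> z}"
      using \<open>y \<le> s\<close> \<open>t \<le> z\<close> \<open>s < t\<close> by (auto simp: W_def J_def)
    then have "finite_perimeter M (J - W)"
      using finite_perimeter_Un shell_fp st K by metis
    moreover have "measure M W = d" using shell_meas[OF \<open>s < t\<close>] st by (simp add: W_def)
    ultimately show ?thesis using shell_fp[OF st(1,2)] unfolding W_def by blast
  qed
  have shell_values: "\<exists>W. finite_perimeter M W \<and> W \<subseteq> J \<and> measure M W = d" if d: "0 < d" "d < L" for d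
  proof (cases "d < 2 * measure N K - L")
    case True
    with small_values d show ?thesis by blast
  next
    case False
    with large d have "0 < L - d" "L - d < 2 * measure N K - L" by (auto simp: L_def)
    then obtain W where W: "W \<subseteq> J" "measure M W = L - d" "finite_perimeter M (J - W)" "finite_perimeter M W"
      using small_values by blast
    then have "measure M (J - W) = d"
      using J_borel J_meas by (subst finite_measure_Diff) (auto simp: sets_eq_borel finite_perimeter_borel)
    with W show ?thesis by blast
  qed
  define P where "P = J \<inter> f -` K"
  have P_borel: "P \<in> sets borel" unfolding P_def using J_borel measurable_sets[OF f K_borel] by simp
  define c where "c = measure M P"
  have c_eq: "c = measure N K"
  proof -
    have "P = f -` (K \<inter> {y<..z})" by (auto simp: P_def J_def)
    then have "c = measure N (K \<inter> {y<..z})" using K_borel by (simp add: c_def N_eq)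
    moreover have "K = (K \<inter> {y<..z}) \<union> {y}" using K(2,3) by fastforce
    then have "measure N K \<le> measure N (K \<inter> {y<..z}) + measure N {y}"
      using measure_Un_le[of "K \<inter> {y<..z}" N "{y}"] K_borel by (metis N.sets_M sets.Int borel_singleton sets.empty_sets greaterThanAtMost_borel insert_is_Un)
    moreover have "measure N (K \<inter> {y<..z}) \<le> measure N K"
      using K_borel by (intro N.finite_measure_mono) (auto simp: N.M_is_borel)
    ultimately show ?thesis using atom[OF K(3)] by simp
  qed
  have c_pos: "c > 0" using large measure_nonneg[of N "{y<..z}"] unfolding c_eq by linarith
  have profile_finite: "iso_profile M (measure M R + s) \<noteq> \<infinity>"
    if R: "R \<in> sets borel" "R \<inter> P = {}" and s: "0 < s" "s < c" for R s
  proof -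
    define t0 where "t0 = measure M (R \<inter> J) + s"
    have "measure M (R \<inter> J) \<le> measure M (J - P)"
      using R J_borel P_borel by (intro finite_measure_mono) (auto simp: sets_eq_borel)
    also have "\<dots> = L - c"
      using J_borel P_borel J_meas by (subst finite_measure_Diff) (auto simp: sets_eq_borel c_def P_def)
    finally have t0: "0 < t0" "t0 < L" using s by (auto simp: t0_def add_nonneg_pos)
    define e where "e = min t0 (L - t0) / 2"
    have e: "e > 0" "e < t0" "e < L - t0" using t0 by (auto simp: e_def min_def)
    define R' where "R' = R - J"
    have R'_borel: "R' \<in> sets borel" using R J_borel by (simp add: R'_def)
    obtain Z where Z: "closed Z" "Z \<subseteq> R'" "measure M R' < measure M Z + e"
    proof -
      have "emeasure M (space M) \<noteq> \<infinity>" by simp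
      note inner = inner_regular[OF sets_eq_borel this R'_borel]
      show ?thesis
      proof (cases "measure M R' < e")
        case True then show ?thesis by (intro that[of "{}"]) auto
      next
        case False
        have "ennreal (measure M R' - e) < emeasure M R'"
          using e False by (simp add: emeasure_eq_measure ennreal_less_iff)
        then obtain Z where Z: "Z \<subseteq> R'" "compact Z" "ennreal (measure M R' - e) < emeasure M Z"
          unfolding inner by (auto simp: less_SUP_iff)
        then have "measure M R' - e < measure M Z"
          using False by (simp add: emeasure_eq_measure ennreal_less_iff)
        with Z show ?thesis by (intro that[of Z]) (auto intro: compact_imp_closed)
      qed
    qed
    obtain A where A: "finite_perimeter M A" "Z \<subseteq> A" "measure M A < measure M Z + e"
      using ex_finite_perimeter_superset[OF Z(1) e(1)] .
    define A0 where "A0 = A \<inter> ({x. f x \<le> y} \<union> {x. z < f x})"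
    have A0: "finite_perimeter M A0"
      unfolding A0_def using A le_fp gt_fp K by (intro finite_perimeter_Int finite_perimeter_Un) auto
    have sets: "A0 \<in> sets M" "A \<in> sets M" "Z \<in> sets M" "R' \<in> sets M"
      using A0 A(1) Z(1) R'_borel by (auto simp: sets_eq_borel finite_perimeter_borel)
    have "Z \<subseteq> A0" using A Z by (auto simp: A0_def R'_def J_def)
    then have "measure M Z \<le> measure M A0" using sets by (intro finite_measure_mono)
    moreover have "measure M A0 \<le> measure M A" using sets by (intro finite_measure_mono) (auto simp: A0_def)
    moreover have "measure M Z \<le> measure M R'" using sets Z by (intro finite_measure_mono)
    ultimately have close: "\<bar>measure M R' - measure M A0\<bar> < e" using Z A by (simp add: abs_less_iff)
    define v where "v = measure M R + s"
    have "R = (R \<inter> J) \<union> R'" by (auto simp: R'_def)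
    then have "measure M R = measure M (R \<inter> J) + measure M R'"
      using R J_borel sets finite_measure_Union[of "R \<inter> J" R'] by (auto simp: sets_eq_borel R'_def)
    then have v: "v = t0 + measure M R'" by (simp add: v_def t0_def)
    define d where "d = v - measure M A0"
    have "0 < d" "d < L" using close e by (auto simp: d_def v abs_less_iff)
    with shell_values obtain W where W: "finite_perimeter M W" "W \<subseteq> J" "measure M W = d" by blast
    have "A0 \<inter> W = {}" using W by (auto simp: A0_def J_def)
    then have "measure M (A0 \<union> W) = v"
      using sets W by (subst finite_measure_Union) (auto simp: d_def sets_eq_borel finite_perimeter_borel)
    moreover have fp: "finite_perimeter M (A0 \<union> W)" using A0 W by (intro finite_perimeter_Un)
    ultimately have "iso_profile M v \<le> boundary_measure M (A0 \<union> W)"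
      unfolding iso_profile_def by (intro INF_lower) (auto simp: finite_perimeter_borel)
    also have "\<dots> < \<infinity>" using fp by (rule boundary_measure_finite)
    finally show ?thesis by (simp add: v_def)
  qed
  define Bad where "Bad = {v \<in> Im_measure M. iso_profile M v = \<infinity>}"
  define Base where "Base = measure M ` {R \<in> sets borel. R \<inter> P = {}}"
  have separated: "v + c \<le> w" if v: "v \<in> Base" and w: "iso_profile M w = \<infinity>" "v < w" for v w
  proof (rule ccontr)
    assume "\<not> v + c \<le> w"
    from v obtain R where R: "R \<in> sets borel" "R \<inter> P = {}" "v = measure M R"
      by (auto simp: Base_def)
    with w \<open>\<not> v + c \<le> w\<close> show False
      using profile_finite[OF R(1,2), of "w - v"] by simp
  qed
  have Bad_sub: "Bad \<subseteq> (Bad \<inter> Base) \<union> (\<lambda>v. v + c) ` (Base \<inter> {v. iso_profile M (v + c) = \<infinity>})"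
  proof
    fix v assume v: "v \<in> Bad"
    then obtain B where B: "B \<in> sets borel" "v = measure M B" by (auto simp: Bad_def Im_measure_def)
    define s where "s = measure M (B \<inter> P)"
    have "(B - P) \<inter> (B \<inter> P) = {}" by blast
    then have "measure M (B - P) + s = v"
      using B P_borel finite_measure_Union[of "B - P" "B \<inter> P"] by (auto simp: s_def sets_eq_borel Un_Diff_Int)
    moreover have "0 \<le> s" "s \<le> c"
      using B P_borel by (auto simp: s_def c_def sets_eq_borel intro!: finite_measure_mono)
    moreover have "measure M (B - P) \<in> Base" using B P_borel by (auto simp: Base_def)
    moreover have "\<not> (0 < s \<and> s < c)"
      using profile_finite[of "B - P" s] B P_borel v \<open>measure M (B - P) + s = v\<close> by (auto simp: Bad_def)
    ultimately have "s = 0 \<or> s = c" "v - s \<in> Base" by (auto simp: algebra_simps)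
    then consider "s = 0" "v \<in> Base" | "s = c" "v - c \<in> Base" by auto
    then show "v \<in> (Bad \<inter> Base) \<union> (\<lambda>v. v + c) ` (Base \<inter> {v. iso_profile M (v + c) = \<infinity>})"
      using v by cases (auto simp: Bad_def intro!: image_eqI[of _ _ "v - c"])
  qed
  have countable_sep: "countable X" if sep: "\<And>v w. v \<in> X \<Longrightarrow> w \<in> X \<Longrightarrow> v < w \<Longrightarrow> v + c \<le> w" for X :: "real set"
  proof (rule countable_image_inj_on)
    show "countable ((\<lambda>v. \<lfloor>v / c\<rfloor>) ` X)" by simp
    show "inj_on (\<lambda>v. \<lfloor>v / c\<rfloor>) X"
    proof (rule linorder_inj_onI)
      fix v w assume "v < w" "v \<in> X" "w \<in> X"
      from sep[OF this(2,3,1)] have "(v + c) / c \<le> w / c" using c_pos by (intro divide_right_mono) auto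
      then have "v / c + 1 \<le> w / c" using c_pos by (simp add: add_divide_distrib)
      then show "\<lfloor>v / c\<rfloor> \<noteq> \<lfloor>w / c\<rfloor>" by linarith
    qed auto
  qed
  have "countable (Bad \<inter> Base)"
    by (rule countable_sep) (auto simp: Bad_def intro: separated)
  moreover have "countable (Base \<inter> {v. iso_profile M (v + c) = \<infinity>})"
  proof (rule countable_sep)
    fix v w assume "v \<in> Base \<inter> {v. iso_profile M (v + c) = \<infinity>}" "w \<in> Base \<inter> {v. iso_profile M (v + c) = \<infinity>}" "v < w"
    then show "v + c \<le> w"
      using separated[of w "v + c"] by (cases "w < v + c") auto
  qed
  ultimately have "countable Bad" using Bad_sub by (meson countable_Un countable_image countable_subset)
  then show ?thesis by (simp add: Bad_def)
qed

end

section \<open>The isoperimetric comparison\<close>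

text \<open>
  A function measurable on an arbitrary subspace extends: each set \<open>{f < q}\<close> with \<open>q\<close>
  rational is the trace of a measurable set, and the extension is the infimum of those \<open>q\<close> whose
  set contains the point.
\<close>
lemma ennreal_extension_from_restrict_space:
  fixes f :: "'a \<Rightarrow> ennreal"
  assumes f: "f \<in> borel_measurable (restrict_space M \<Omega>)" and space: "space M = UNIV"
  obtains g where "g \<in> borel_measurable M" "\<And>x. x \<in> \<Omega> \<Longrightarrow> g x = f x"
proof -
  define Q :: "ennreal set" where "Q = ennreal ` \<rat>"
  have Q_count: "countable Q" unfolding Q_def by (intro countable_image countable_rat)
  have "\<exists>S\<in>sets M. {x\<in>\<Omega>. f x < q} = \<Omega> \<inter> S" for q
  proof -
    have "f -` {..<q} \<inter> space (restrict_space M \<Omega>) \<in> sets (restrict_space M \<Omega>)"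
      by (rule measurable_sets[OF f]) simp
    then have "f -` {..<q} \<inter> \<Omega> \<in> (\<inter>) \<Omega> ` sets M"
      by (simp add: space_restrict_space space sets_restrict_space)
    moreover have "{x\<in>\<Omega>. f x < q} = f -` {..<q} \<inter> \<Omega>" by auto
    ultimately show ?thesis by auto
  qed
  then obtain S where S: "\<And>q. S q \<in> sets M" "\<And>q. {x\<in>\<Omega>. f x < q} = \<Omega> \<inter> S q" by metis
  define g where "g x = (INF q\<in>Q. if x \<in> S q then q else \<infinity>)" for x
  have "(\<lambda>x. if x \<in> S q then q else \<infinity>) \<in> borel_measurable M" for q
    using S(1) by (intro measurable_If_set) (auto simp: space)
  then have "g \<in> borel_measurable M" unfolding g_def[abs_def] by (intro borel_measurable_INF Q_count)
  moreover have "g x = f x" if x: "x \<in> \<Omega>" for x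
  proof -
    have S_iff: "x \<in> S q \<longleftrightarrow> f x < q" for q using S(2)[of q] x by auto
    show ?thesis
    proof (rule antisym)
      show "f x \<le> g x" unfolding g_def by (intro INF_greatest) (auto simp: S_iff less_imp_le)
      show "g x \<le> f x"
      proof (rule dense_ge)
        fix b assume "f x < b"
        then obtain r where r: "f x < ennreal (real_of_rat r)" "ennreal (real_of_rat r) < b"
          using ennreal_rat_dense by metis
        have "g x \<le> ennreal (real_of_rat r)"
          unfolding g_def by (rule INF_lower2[of "ennreal (real_of_rat r)"]) (use r in \<open>auto simp: Q_def S_iff\<close>)
        with r show "g x \<le> b" by simp
      qed
    qed
  qed
  ultimately show ?thesis by (rule that)
qed

lemma (in mm_space) iso_profile_0: "iso_profile M 0 = 0"
proof -
  have "iso_profile M 0 \<le> boundary_measure M {}"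
    unfolding iso_profile_def by (intro INF_lower) auto
  also have "\<dots> \<le> ennreal 0"
    unfolding boundary_measure_def by (rule Limsup_bounded) (simp add: nbhd_def)
  finally show ?thesis by simp
qed

lemma (in mm_space) iso_profile_1: "iso_profile M 1 = 0"
proof -
  have UNIV: "measure M UNIV = 1" using prob_space by (simp add: sets_eq_imp_space_eq[OF sets_eq_borel])
  then have "iso_profile M 1 \<le> boundary_measure M UNIV"
    unfolding iso_profile_def by (intro INF_lower) auto
  also have "\<dots> \<le> ennreal 0"
    unfolding boundary_measure_def
  proof (rule Limsup_bounded, unfold eventually_at_right_field, intro exI[of _ 1] conjI allI impI)
    fix e :: real assume "0 < e"
    then have "nbhd e UNIV = (UNIV :: 'a set)" using subset_nbhd[of e UNIV] by blast
    then show "ennreal ((measure M (nbhd e UNIV) - measure M UNIV) / e) \<le> ennreal 0" by simp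
  qed simp
  finally show ?thesis by simp
qed

lemma (in mm_space) iso_profile_ge_cheeger:
  assumes "0 < v" "v < 1" "0 \<le> c" "ennreal c \<le> cheeger M"
  shows "ennreal (c * min v (1 - v)) \<le> iso_profile M v"
  unfolding iso_profile_def using assms by (intro INF_greatest) (auto dest: boundary_measure_ge_cheeger)

theorem proposition6p2:
  fixes M :: "'a::polish_space measure"
  assumes "mm_space M"
    and "0 < cheeger M"
  shows "essentially_connected M
    \<and> (\<exists>\<nu>\<in>\<V>. IC M \<nu>)
    \<and> (iso_profile M \<in> borel_measurable (lebesgue_on (Im_measure M)) \<longrightarrow>
        (\<exists>\<nu>\<in>\<V>. AE t in lebesgue. cdf \<nu> t \<in> Im_measure M \<longrightarrow>
           iso_profile M (cdf \<nu> t) = ennreal (deriv (cdf \<nu>) t)))"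
proof -
  interpret mm_space M by fact
  obtain c where c: "0 < c" "c \<le> 1" "ennreal c \<le> cheeger M"
  proof (cases "cheeger M")
    case (real h)
    with assms(2) show ?thesis by (intro that[of "min 1 h"]) (auto simp: ennreal_leI)
  next
    case top
    then show ?thesis by (intro that[of 1]) auto
  qed
  have lower: "ennreal (c * min v (1 - v)) \<le> iso_profile M v" if "0 < v" "v < 1" for v
    using that c by (intro iso_profile_ge_cheeger) auto
  have "essentially_connected M"
    unfolding essentially_connected_def
  proof (intro allI impI)
    fix A :: "'a set" assume A: "closed A \<and> 0 < measure M A \<and> measure M A < 1"
    then have "ennreal (c * min (measure M A) (1 - measure M A)) \<le> boundary_measure M A"
      using c by (intro boundary_measure_ge_cheeger) auto
    moreover have "0 < ennreal (c * min (measure M A) (1 - measure M A))" using A c by simp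
    ultimately show "0 < boundary_measure M A" by (rule order.strict_trans2[rotated])
  qed
  moreover have "\<exists>\<nu>\<in>\<V>. IC M \<nu>"
  proof -
    define J where "J v = c * min v (1 - v)" for v :: real
    have "J \<in> borel_measurable borel" unfolding J_def by measurable
    then obtain \<nu> where \<nu>: "\<nu> \<in> \<V>"
      and AE: "AE t in lborel. (cdf \<nu> t \<in> {0, 1} \<and> deriv (cdf \<nu>) t = 0) \<or>
        (cdf \<nu> t \<in> {0<..<1} - {} \<and> deriv (cdf \<nu>) t = J (cdf \<nu> t))"
      by (rule ex_distribution_with_profile[OF c(1), of J "{}"]) (auto simp: J_def)
    have "AE t in lebesgue. ennreal (deriv (cdf \<nu>) t) \<le> iso_profile M (cdf \<nu> t)"
      using AE_completion[OF AE] by eventually_elim (auto simp: J_def lower)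
    then have "IC M \<nu>" unfolding IC_def by eventually_elim simp
    with \<nu> show ?thesis by blast
  qed
  moreover have "\<exists>\<nu>\<in>\<V>. AE t in lebesgue. cdf \<nu> t \<in> Im_measure M \<longrightarrow>
           iso_profile M (cdf \<nu> t) = ennreal (deriv (cdf \<nu>) t)"
    if meas: "iso_profile M \<in> borel_measurable (lebesgue_on (Im_measure M))"
  proof -
    \<comment> \<open>A Borel function that agrees with the profile at almost every value of \<open>M\<close>.\<close>
    obtain g0 where g0: "g0 \<in> borel_measurable lebesgue" "\<And>v. v \<in> Im_measure M \<Longrightarrow> g0 v = iso_profile M v"
      using ennreal_extension_from_restrict_space[OF meas] by auto
    obtain g where g[measurable]: "g \<in> borel_measurable borel" and g_eq: "AE v in lborel. g0 v = g v"
      using completion_ex_borel_measurable[OF g0(1)] by auto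
    have "AE v in lborel. v \<notin> {v \<in> Im_measure M. iso_profile M v = \<infinity>}"
      using countable_imp_null_set_lborel[OF finite_profile_off_countable[OF assms(2)]] by (rule AE_not_in)
    with g_eq have "AE v in lborel. v \<in> Im_measure M \<longrightarrow> g v = iso_profile M v \<and> g v \<noteq> \<infinity>"
      by eventually_elim (auto simp: g0(2))
    then obtain E where E: "E \<in> null_sets lborel"
      and gE: "{v. \<not> (v \<in> Im_measure M \<longrightarrow> g v = iso_profile M v \<and> g v \<noteq> \<infinity>)} \<subseteq> E"
      by (auto elim!: AE_E simp: null_sets_def)
    \<comment> \<open>The value 1 is at least \<open>c * min v (1 - v)\<close> because \<open>c \<le> 1\<close>. It takes effect
      only on a null set and at numbers that are not the measure of any set.\<close>
    define J where "J v = (if ennreal (c * min v (1 - v)) \<le> g v \<and> g v \<noteq> \<infinity> then enn2real (g v) else 1)" for v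
    have J: "J \<in> borel_measurable borel" unfolding J_def by measurable
    have J_lower: "c * min v (1 - v) \<le> J v" if v: "0 < v" "v < 1" for v
    proof (cases "ennreal (c * min v (1 - v)) \<le> g v \<and> g v \<noteq> \<infinity>")
      case True
      then have "c * min v (1 - v) \<le> enn2real (g v)"
        by (cases "g v") (auto simp: ennreal_le_iff)
      with True show ?thesis by (simp add: J_def)
    next
      case False
      have "c * min v (1 - v) \<le> 1 * 1" using c v by (intro mult_mono) auto
      with False show ?thesis by (auto simp: J_def)
    qed
    have J_eq: "ennreal (J v) = iso_profile M v" if "v \<in> Im_measure M" "0 < v" "v < 1" "v \<notin> E" for v
    proof -
      have gv: "g v = iso_profile M v" "g v \<noteq> \<infinity>" using gE that by auto
      moreover have "ennreal (c * min v (1 - v)) \<le> g v" using lower[OF that(2,3)] gv by simp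
      ultimately show ?thesis by (simp add: J_def less_top)
    qed
    obtain \<nu> where \<nu>: "\<nu> \<in> \<V>"
      and AE: "AE t in lborel. (cdf \<nu> t \<in> {0, 1} \<and> deriv (cdf \<nu>) t = 0) \<or>
        (cdf \<nu> t \<in> {0<..<1} - E \<and> deriv (cdf \<nu>) t = J (cdf \<nu> t))"
      using ex_distribution_with_profile[OF c(1) J J_lower E] by auto
    have "AE t in lebesgue. cdf \<nu> t \<in> Im_measure M \<longrightarrow>
           iso_profile M (cdf \<nu> t) = ennreal (deriv (cdf \<nu>) t)"
      using AE_completion[OF AE] by eventually_elim (auto simp: J_eq iso_profile_0 iso_profile_1)
    with \<nu> show ?thesis by blast
  qed
  ultimately show ?thesis by blast
qed

end
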